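(* Let $f(z)$ be a meromorphic function of finite order $\sigma$, $f\not\equiv0$, let $0<\beta<1$ and $0<|\omega|<r^\beta$. Then, given $0<\varepsilon<(1-\beta)/(2-\beta)$, we have $$m\Big(r,\frac{f(z+\omega)}{f(z)}\Big)+m\Big(r,\frac{f(z)}{f(z+\omega)}\Big)=O\big(r^{\sigma-(1-\beta)(1-\varepsilon)+\varepsilon}\big)\qquad (r\to\infty).$$
   Context: $m(r,g)=\frac1{2\pi}\int_0^{2\pi}\log^+|g(re^{i\theta})|\,d\theta$ is the Nevanlinna proximity function; the order of $f$ is $\sigma=\limsup_{r\to\infty}\log^+T(r,f)/\log r$. The step $\omega=\omega(r)\in\mathbb{C}$ may vary with $r$ freely subject only to the stated bound $0<|\omega|<r^\beta$; for each $r$ the proximity function is computed on $|z|=r$ with that value of $\omega$. *)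

theory Defs
  imports "HOL-Complex_Analysis.Complex_Analysis" "HOL-Library.Landau_Symbols"
begin

text \<open>
  Nevanlinna's characteristic of functions that are meromorphic on the whole plane. The values of
  such a function at its poles, or at any sparse set of points, are irrelevant: they change
  \<open>proximity\<close> only on a null set, and \<^const>\<open>is_pole\<close> and \<^const>\<open>zorder\<close> depend only on
  punctured neighbourhoods.
\<close>

text \<open>Since \<open>ln 0 = 0\<close>, this also gives the usual \<open>log_plus 0 = 0\<close>.\<close>
definition log_plus :: "real \<Rightarrow> real" where
  "log_plus x = max 0 (ln x)"

definition proximity :: "real \<Rightarrow> (complex \<Rightarrow> complex) \<Rightarrow> real" where
  "proximity r g = 1 / (2 * pi) * integral {0..2 * pi} (\<lambda>\<theta>. log_plus (norm (g (rcis r \<theta>))))"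

text \<open>Poles in the closed disc, counted with multiplicity; the order of a pole is \<open>- zorder f z\<close>.\<close>
definition pole_count :: "real \<Rightarrow> (complex \<Rightarrow> complex) \<Rightarrow> nat" where
  "pole_count r f = (\<Sum>z | norm z \<le> r \<and> is_pole f z. nat (- zorder f z))"

definition integrated_pole_count :: "real \<Rightarrow> (complex \<Rightarrow> complex) \<Rightarrow> real" where
  "integrated_pole_count r f =
     integral {0..r} (\<lambda>t. (real (pole_count t f) - real (pole_count 0 f)) / t)
     + real (pole_count 0 f) * ln r"

definition characteristic :: "real \<Rightarrow> (complex \<Rightarrow> complex) \<Rightarrow> real" where
  "characteristic r f = proximity r f + integrated_pole_count r f"

definition growth_order :: "(complex \<Rightarrow> complex) \<Rightarrow> ereal" where
  "growth_order f = Limsup at_top (\<lambda>r. ereal (log_plus (characteristic r f) / ln r))"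

end

theory Submission
  imports Defs
begin

text \<open>
  On a circle \<open>|z| = R\<close> free of zeros and poles, with \<open>4r < R < 5r\<close>, write
  \<open>f(z) = (\<Prod>a. ((z - a)/R)\<^bsup>k a\<^esup>) exp (g z)\<close> in the closed disc, where \<open>a\<close> runs over the zeros and poles in it.
  Then \<open>ln |f(z + \<omega>)/f(z)|\<close> splits into the terms \<open>k a * ln |(z + \<omega> - a)/(z - a)|\<close> and \<open>Re (g(z + \<omega>) - g z)\<close>.
  With \<open>d = 1 - \<epsilon>\<close>, a term of the first kind is at most
  \<open>|k a| |\<omega>|\<^bsup>d\<^esup> (|z + \<omega> - a|\<^bsup>-d\<^esup> + |z - a|\<^bsup>-d\<^esup>) / d\<close>, whose mean over \<open>|z| = r\<close> is \<open>O(|k a| (|\<omega>|/r)\<^bsup>d\<^esup>)\<close>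
  uniformly in \<open>a\<close>. The second is at most \<open>|\<omega>| sup |g'|\<close>, and \<open>g'\<close> is controlled by the mean of \<open>|Re g|\<close> on
  \<open>|z| = R\<close>. Jensen's formula bounds the number of zeros and poles and this mean by the characteristic, hence by
  \<open>O(r\<^bsup>\<sigma> + \<epsilon>\<^esup>)\<close>. Since a non-integrable function has \<^const>\<open>integral\<close> 0, upper bounds for
  \<^const>\<open>proximity\<close> only need an integrable majorant outside a finite set of angles.
\<close>

subsection \<open>Integrals over circles\<close>

text \<open>Since \<open>1 - d > 0\<close>, the antiderivative \<open>F\<close> is continuous across
  the singularity \<open>c\<close>, so the fundamental theorem with the single exceptional point
  \<open>c\<close> applies, wherever \<open>c\<close> lies relative to the interval.\<close>

lemma has_integral_abs_diff_powr:
  fixes c d a b :: real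
  assumes d: "0 < d" "d < 1" and ab: "a \<le> b"
  defines "F \<equiv> (\<lambda>x. sgn (x - c) * \<bar>x - c\<bar> powr (1 - d) / (1 - d))"
  shows "((\<lambda>x. \<bar>x - c\<bar> powr (-d)) has_integral (F b - F a)) {a..b}"
proof (rule fundamental_theorem_of_calculus_strong[of "{c}"])
  have F: "F x = (if x \<ge> c then (x - c) powr (1 - d) / (1 - d) else - ((c - x) powr (1 - d) / (1 - d)))" for x
    by (auto simp: F_def sgn_if)
  show "continuous_on {a..b} F"
    unfolding F
  proof (rule continuous_on_subset[of UNIV])
    have "continuous_on ({c..} \<union> {..c}) (\<lambda>x. if x \<ge> c then (x - c) powr (1 - d) / (1 - d) else - ((c - x) powr (1 - d) / (1 - d)))"
      by (rule continuous_on_If) (use d in \<open>auto intro!: continuous_intros continuous_on_powr'\<close>)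
    also have "{c..} \<union> {..c} = UNIV" by auto
    finally show "continuous_on UNIV (\<lambda>x. if x \<ge> c then (x - c) powr (1 - d) / (1 - d) else - ((c - x) powr (1 - d) / (1 - d)))" .
  qed auto
  show "(F has_vector_derivative \<bar>x - c\<bar> powr - d) (at x)" if x: "x \<in> {a..b} - {c}" for x
  proof (cases "x > c")
    case True
    have "((\<lambda>x. (x - c) powr (1 - d) / (1 - d)) has_real_derivative (1 - d) * (x - c) powr (1 - d - 1) / (1 - d)) (at x)"
      using True by (auto intro!: derivative_eq_intros)
    hence "((\<lambda>x. (x - c) powr (1 - d) / (1 - d)) has_real_derivative \<bar>x - c\<bar> powr - d) (at x)"
      using True d by simp
    note D = this
    have "\<forall>\<^sub>F y in nhds x. y \<in> {c<..}"
      by (rule eventually_nhds_in_open) (use True in auto)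
    hence ev: "\<forall>\<^sub>F y in nhds x. F y = (y - c) powr (1 - d) / (1 - d)"
      by eventually_elim (auto simp: F)
    have "(F has_real_derivative \<bar>x - c\<bar> powr - d) (at x)"
      by (rule DERIV_cong_ev[OF refl ev refl, THEN iffD2, OF D])
    thus ?thesis by (simp add: has_real_derivative_iff_has_vector_derivative)
  next
    case False
    hence lt: "x < c" using x by auto
    have "((\<lambda>x. - ((c - x) powr (1 - d) / (1 - d))) has_real_derivative (1 - d) * (c - x) powr (1 - d - 1) / (1 - d)) (at x)"
      using lt by (auto intro!: derivative_eq_intros)
    hence "((\<lambda>x. - ((c - x) powr (1 - d) / (1 - d))) has_real_derivative \<bar>x - c\<bar> powr - d) (at x)"
      using lt d by simp
    note D = this
    have "\<forall>\<^sub>F y in nhds x. y \<in> {..<c}"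
      by (rule eventually_nhds_in_open) (use lt in auto)
    hence ev: "\<forall>\<^sub>F y in nhds x. F y = - ((c - y) powr (1 - d) / (1 - d))"
      by eventually_elim (auto simp: F)
    have "(F has_real_derivative \<bar>x - c\<bar> powr - d) (at x)"
      by (rule DERIV_cong_ev[OF refl ev refl, THEN iffD2, OF D])
    thus ?thesis by (simp add: has_real_derivative_iff_has_vector_derivative)
  qed
qed (use ab in auto)

text \<open>Taylor's theorem gives \<open>|sin v - v| \<le> |v|^3 / 6\<close>, which is at most
  \<open>2/3 |v|\<close> for \<open>|v| \<le> 2\<close>. This range contains \<open>pi / 2\<close>,
  the largest remainder after rounding to a multiple of \<open>pi\<close>.\<close>

lemma abs_sin_ge:
  fixes v :: real
  assumes "\<bar>v\<bar> \<le> 2"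
  shows "\<bar>v\<bar> / 3 \<le> \<bar>sin v\<bar>"
proof -
  have "\<bar>sin v - (\<Sum>m<3. sin_coeff m * v ^ m)\<bar> \<le> inverse (fact 3) * \<bar>v\<bar> ^ 3"
    by (rule Maclaurin_sin_bound)
  hence "\<bar>sin v - v\<bar> \<le> \<bar>v\<bar> ^ 3 / 6"
    by (simp add: eval_nat_numeral sin_coeff_def)
  also have "\<bar>v\<bar> ^ 3 / 6 = \<bar>v\<bar> * (\<bar>v\<bar> ^ 2 / 6)"
    by (simp add: eval_nat_numeral)
  also have "\<dots> \<le> \<bar>v\<bar> * (2 ^ 2 / 6)"
    using assms by (intro mult_left_mono divide_right_mono power_mono) auto
  finally have "\<bar>sin v - v\<bar> \<le> \<bar>v\<bar> * (2 / 3)" by simp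
  thus ?thesis by linarith
qed

text \<open>Rounding \<open>u / pi\<close> leaves a remainder of at most \<open>pi / 2 < 2\<close>,
  and \<open>|sin|\<close> has period \<open>pi\<close>. The range of \<open>u\<close> is that of
  \<open>\<theta> - Arg w\<close> for \<open>\<theta>\<close> in \<open>[0, 2 pi]\<close>, so five
  values of \<open>k\<close> serve a whole circle.\<close>

lemma abs_sin_ge_dist_pi_multiple:
  fixes u :: real
  assumes "- pi \<le> u" "u \<le> 3 * pi"
  obtains k :: int where "k \<in> {-1..3}" "\<bar>u - of_int k * pi\<bar> / 3 \<le> \<bar>sin u\<bar>"
proof -
  define k where "k = round (u / pi)"
  have k: "\<bar>u / pi - of_int k\<bar> \<le> 1 / 2"
    unfolding k_def using of_int_round_abs_le[of "u / pi"] by (simp add: abs_minus_commute)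
  have "round (of_int (-1) :: real) \<le> k" "k \<le> round (3 :: real)"
    unfolding k_def by (rule round_mono; use assms in \<open>simp add: field_simps\<close>)+
  hence k': "k \<in> {-1..3}"
    unfolding round_of_int by simp
  define v where "v = u - of_int k * pi"
  have "\<bar>v\<bar> = \<bar>u / pi - of_int k\<bar> * pi"
    using pi_gt_zero by (simp add: v_def abs_mult_pos' field_simps flip: abs_mult_pos)
  also have "\<dots> \<le> (1 / 2) * 4"
    using k pi_less_4 by (intro mult_mono) auto
  finally have v: "\<bar>v\<bar> / 3 \<le> \<bar>sin v\<bar>" by (intro abs_sin_ge) auto
  have "sin u = sin (v + of_int k * pi)" by (simp add: v_def)
  hence "\<bar>sin u\<bar> = \<bar>sin v * cos (of_int k * pi)\<bar>"
    using sin_npi_int[of k] by (simp add: sin_add mult.commute)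
  also have "\<dots> = \<bar>sin v\<bar>"
    using sin_cos_squared_add[of "of_int k * pi"] sin_npi_int[of k]
    by (simp add: abs_mult abs_square_eq_1 mult.commute)
  finally show ?thesis using that[OF k'] v unfolding v_def by simp
qed

text \<open>Angles of the same point differ by a multiple of \<open>2 pi\<close>, and in this
  interval only the multiples -1, 0, 1 can occur. Finite exceptional sets in the plane are therefore
  negligible for circle integrals.\<close>

lemma finite_rcis_vimage:
  assumes "r > 0" "finite E"
  shows "finite {\<theta> \<in> {0..2*pi}. rcis r \<theta> \<in> E}"
proof -
  have "finite {\<theta> \<in> {0..2*pi}. rcis r \<theta> = z}" for z
  proof (cases "\<exists>\<theta>\<in>{0..2*pi}. rcis r \<theta> = z")
    case True
    then obtain \<phi> where \<phi>: "\<phi> \<in> {0..2*pi}" "rcis r \<phi> = z" by auto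
    have "\<theta> \<in> {\<phi>, \<phi> - 2 * pi, \<phi> + 2 * pi}" if \<theta>: "\<theta> \<in> {0..2*pi}" "rcis r \<theta> = z" for \<theta>
    proof -
      have "cis \<theta> = cis \<phi>" using \<theta> \<phi> assms by (auto simp: rcis_def)
      hence "sin \<theta> = sin \<phi> \<and> cos \<theta> = cos \<phi>" by (metis cis.sel)
      then obtain n where n: "\<theta> = \<phi> + 2 * pi * of_int n"
        using sin_cos_eq_iff[of \<theta> \<phi>] by auto
      have "\<bar>2 * pi * of_int n\<bar> \<le> 2 * pi * 1" using n \<theta> \<phi> by auto
      hence "\<bar>n\<bar> \<le> 1" by (simp add: abs_mult flip: of_int_abs) 
      hence "n = -1 \<or> n = 0 \<or> n = 1" by linarith
      thus ?thesis using n by auto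
    qed
    hence "{\<theta> \<in> {0..2*pi}. rcis r \<theta> = z} \<subseteq> {\<phi>, \<phi> - 2 * pi, \<phi> + 2 * pi}" by blast
    thus ?thesis by (rule finite_subset) simp
  next
    case False
    hence "{\<theta> \<in> {0..2*pi}. rcis r \<theta> = z} = {}" by auto
    thus ?thesis by (metis finite.emptyI)
  qed
  moreover have "{\<theta> \<in> {0..2*pi}. rcis r \<theta> \<in> E} = (\<Union>z\<in>E. {\<theta> \<in> {0..2*pi}. rcis r \<theta> = z})" by auto
  ultimately show ?thesis using assms by auto
qed

text \<open>If \<open>f\<close> is not integrable, its \<open>integral\<close> is 0, which
  nonnegativity of \<open>g\<close> covers. Proximity functions can thus be bounded without studying
  the integrability of shift quotients.\<close>

lemma integral_le_nonneg_majorant: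
  fixes f g :: "real \<Rightarrow> real"
  assumes "g integrable_on S" "finite X" "\<And>x. x \<in> S - X \<Longrightarrow> f x \<le> g x" "\<And>x. x \<in> S \<Longrightarrow> 0 \<le> g x"
  shows "integral S f \<le> integral S g"
proof (cases "f integrable_on S")
  case True
  have "integral S f = integral S (\<lambda>x. if x \<in> X then g x else f x)"
    by (rule integral_spike[of X]) (use assms(2) in auto)
  also have "\<dots> \<le> integral S g"
  proof (rule integral_le)
    show "(\<lambda>x. if x \<in> X then g x else f x) integrable_on S"
      by (rule integrable_spike[OF True, of X]) (use assms(2) in auto)
  qed (use assms in auto)
  finally show ?thesis .
next
  case False
  hence "integral S f = 0" by (rule not_integrable_integral)
  also have "0 \<le> integral S g" by (rule integral_nonneg) (use assms in auto)
  finally show ?thesis .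
qed

text \<open>Rotating by \<open>- Arg w\<close> moves \<open>w\<close> to the nonnegative real axis,
  and the distance to the real line is the absolute imaginary part.\<close>

lemma norm_rcis_diff_ge:
  assumes "r \<ge> 0"
  shows "r * \<bar>sin (\<theta> - Arg w)\<bar> \<le> norm (rcis r \<theta> - w)"
proof -
  have "r * \<bar>sin (\<theta> - Arg w)\<bar> = \<bar>Im (rcis r (\<theta> - Arg w) - of_real (norm w))\<bar>"
    using assms by (simp add: rcis_def abs_mult)
  also have "\<dots> \<le> norm (rcis r (\<theta> - Arg w) - of_real (norm w))"
    by (rule abs_Im_le_cmod)
  also have "\<dots> = norm (cis (Arg w) * (rcis r (\<theta> - Arg w) - of_real (norm w)))"
    by (simp add: norm_mult)
  also have "cis (Arg w) * (rcis r (\<theta> - Arg w) - of_real (norm w)) = rcis r \<theta> - rcis (norm w) (Arg w)"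
    by (simp add: rcis_def algebra_simps cis_mult)
  finally show ?thesis by (simp add: rcis_cmod_Arg)
qed

text \<open>Uniformity in \<open>w\<close> comes from comparing angles only: the distance is at
  least \<open>r |\<theta> - c k| / 3\<close> for one of five angles \<open>c k\<close>, so five
  integrable singularities together dominate the integrand.\<close>

lemma circle_integral_powr_bound:
  fixes d :: real
  assumes d: "0 < d" "d < 1"
  obtains K where "K > 0"
    "\<And>r w. r > 0 \<Longrightarrow> (\<lambda>\<theta>. norm (rcis r \<theta> - w) powr -d) integrable_on {0..2*pi}"
    "\<And>r w. r > 0 \<Longrightarrow> integral {0..2*pi} (\<lambda>\<theta>. norm (rcis r \<theta> - w) powr -d) \<le> K * r powr -d"
proof -
  \<comment> \<open>\<open>B\<close> bounds one singular integral: every \<open>c k\<close> lies in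
    \<open>[-2 pi, 4 pi]\<close>, within \<open>4 pi\<close> of both endpoints, and two endpoint
    values give the factor 2. \<open>K\<close> then collects five values of \<open>k\<close> and the
    factor 1/3 of the sine bound.\<close>
  define B where "B = 2 * (4 * pi) powr (1 - d) / (1 - d)"
  define K where "K = 5 * (3 powr d * B)"
  have "K > 0" using d by (simp add: K_def B_def)
  moreover have "(\<lambda>\<theta>. norm (rcis r \<theta> - w) powr -d) integrable_on {0..2*pi} \<and>
    integral {0..2*pi} (\<lambda>\<theta>. norm (rcis r \<theta> - w) powr -d) \<le> K * r powr -d" if r: "r > 0" for r w
  proof -
    define c where "c = (\<lambda>k::int. Arg w + of_int k * pi)"
    define I where "I = {-1..3::int}"
    have [simp]: "finite I" and cardI: "card I = 5" by (auto simp: I_def)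
    define f where "f = (\<lambda>\<theta>. norm (rcis r \<theta> - w) powr -d)"
    define H where "H = (\<lambda>\<theta>. r powr -d * (\<Sum>k\<in>I. 3 powr d * \<bar>\<theta> - c k\<bar> powr -d))"
    have sing: "(\<lambda>\<theta>. \<bar>\<theta> - c k\<bar> powr -d) integrable_on {0..2*pi} \<and>
        integral {0..2*pi} (\<lambda>\<theta>. \<bar>\<theta> - c k\<bar> powr -d) \<le> B" if k: "k \<in> I" for k
    proof -
      define F where "F = (\<lambda>x. sgn (x - c k) * \<bar>x - c k\<bar> powr (1 - d) / (1 - d))"
      have int: "((\<lambda>x. \<bar>x - c k\<bar> powr (-d)) has_integral (F (2*pi) - F 0)) {0..2*pi}"
        unfolding F_def by (rule has_integral_abs_diff_powr) (use d in auto)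
      have "-pi < Arg w" "Arg w \<le> pi" using Arg_bounded[of w] by auto
      moreover have "-1 \<le> real_of_int k" "real_of_int k \<le> 3" using k by (auto simp: I_def)
      hence "-1 * pi \<le> of_int k * pi" "of_int k * pi \<le> 3 * pi" by (intro mult_right_mono; simp)+
      ultimately have c: "-2 * pi \<le> c k" "c k \<le> 4 * pi" unfolding c_def by linarith+
      have F: "\<bar>F x\<bar> \<le> (4 * pi) powr (1 - d) / (1 - d)" if "x \<in> {0, 2 * pi}" for x
      proof -
        have "\<bar>F x\<bar> \<le> \<bar>x - c k\<bar> powr (1 - d) / (1 - d)"
          using d by (auto simp: F_def sgn_if)
        also have "\<dots> \<le> (4 * pi) powr (1 - d) / (1 - d)"
          using d c that by (intro divide_right_mono powr_mono2) auto
        finally show ?thesis .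
      qed
      have "F (2*pi) - F 0 \<le> B" using F[of 0] F[of "2*pi"] by (simp add: B_def)
      thus ?thesis using int by (auto simp: integrable_on_def integral_unique)
    qed
    have Hint: "H integrable_on {0..2*pi}"
      unfolding H_def by (intro integrable_on_mult_right integrable_sum \<open>finite I\<close>) (use sing in blast)
    have "integral {0..2*pi} H = r powr -d * (\<Sum>k\<in>I. 3 powr d * integral {0..2*pi} (\<lambda>\<theta>. \<bar>\<theta> - c k\<bar> powr -d))"
      unfolding H_def by (subst integral_mult_right, subst integral_sum) (use sing in \<open>auto intro!: integrable_on_mult_right\<close>)
    also have "\<dots> \<le> r powr -d * (\<Sum>k\<in>I. 3 powr d * B)"
      by (intro mult_left_mono sum_mono) (use sing in auto)
    finally have HK: "integral {0..2*pi} H \<le> K * r powr -d" by (simp add: K_def cardI mult_ac)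
    have fH: "f \<theta> \<le> H \<theta>" if "\<theta> \<in> {0..2*pi} - c ` I" for \<theta>
    proof -
      have "- pi \<le> \<theta> - Arg w" "\<theta> - Arg w \<le> 3 * pi"
        using that Arg_bounded[of w] by auto
      then obtain k where k: "k \<in> I" "\<bar>\<theta> - Arg w - of_int k * pi\<bar> / 3 \<le> \<bar>sin (\<theta> - Arg w)\<bar>"
        unfolding I_def by (rule abs_sin_ge_dist_pi_multiple)
      hence k2: "\<bar>\<theta> - c k\<bar> / 3 \<le> \<bar>sin (\<theta> - Arg w)\<bar>" by (simp add: c_def algebra_simps)
      have pos: "\<bar>\<theta> - c k\<bar> > 0" using that k by auto
      have "r * (\<bar>\<theta> - c k\<bar> / 3) \<le> r * \<bar>sin (\<theta> - Arg w)\<bar>"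
        using k2 r by (intro mult_left_mono) auto
      also have "\<dots> \<le> norm (rcis r \<theta> - w)" using r by (intro norm_rcis_diff_ge) auto
      finally have "f \<theta> \<le> (r * (\<bar>\<theta> - c k\<bar> / 3)) powr -d"
        unfolding f_def using r pos d by (intro powr_mono2') auto
      also have "\<dots> = r powr -d * (3 powr d * \<bar>\<theta> - c k\<bar> powr -d)"
        using r pos by (simp add: powr_mult powr_divide powr_minus field_simps)
      also have "\<dots> \<le> H \<theta>"
        unfolding H_def using k by (intro mult_left_mono member_le_sum) auto
      finally show ?thesis .
    qed
    have H0: "H \<theta> \<ge> 0" for \<theta> unfolding H_def by (intro mult_nonneg_nonneg sum_nonneg) auto
    \<comment> \<open>At \<open>c k\<close> the corresponding summand of \<open>H\<close> is 0,
      because \<open>0 powr -d = 0\<close>, so \<open>H\<close> need not dominate \<open>f\<close>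
      there. Replacing it by \<open>f\<close> at finitely many angles keeps it integrable.\<close>
    define g where "g = (\<lambda>\<theta>. if \<theta> \<in> c ` I then f \<theta> else H \<theta>)"
    have [measurable]: "(\<lambda>\<theta>. norm (rcis r \<theta> - w)) \<in> borel_measurable borel"
      by (intro borel_measurable_continuous_onI continuous_intros)
    have "f \<in> borel_measurable borel" unfolding f_def by measurable
    hence "f \<in> borel_measurable lebesgue"
      by (intro measurable_completion) auto
    hence fm: "f \<in> borel_measurable (lebesgue_on {0..2*pi})"
      by (rule measurable_restrict_space1)
    have gint: "g integrable_on {0..2*pi}"
      by (rule integrable_spike[OF Hint, of "c ` I"]) (auto simp: g_def)
    have "f integrable_on {0..2*pi}"
      by (rule measurable_bounded_by_integrable_imp_integrable[OF fm gint])
         (use fH in \<open>auto simp: g_def f_def\<close>)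
    moreover have "integral {0..2*pi} f \<le> integral {0..2*pi} H"
      by (rule integral_le_nonneg_majorant[OF Hint, of "c ` I"]) (use fH H0 in auto)
    ultimately show ?thesis using HK unfolding f_def by linarith
  qed
  ultimately show ?thesis using that by blast
qed

text \<open>For \<open>y \<le> 1\<close>, \<open>ln (1 + y) \<le> y \<le> y powr d\<close>. For
  larger \<open>y\<close>, \<open>ln (2 y)\<close> is bounded through
  \<open>ln y = ln (y powr d) / d\<close> and \<open>ln 2 \<le> 1 / d\<close>. With
  \<open>d < 1\<close> this trades a logarithmic singularity for an integrable power.\<close>

lemma ln_1_plus_le_powr:
  fixes y d :: real
  assumes "0 < d" "d \<le> 1" "0 \<le> y"
  shows "ln (1 + y) \<le> y powr d / d"
proof (cases "y \<le> 1")
  case True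
  have "ln (1 + y) \<le> y" using assms by (intro ln_add_one_self_le_self) auto
  also have "y = y powr 1" using assms by simp
  also have "y powr 1 \<le> y powr d"
    using True assms powr_mono'[of d 1 y] by auto
  also have "\<dots> \<le> y powr d / d" using assms using mult_left_mono[of d 1 "y powr d"] by (simp add: field_simps)
  finally show ?thesis .
next
  case False
  have "ln (1 + y) \<le> ln (2 * y)" using False by (intro ln_mono) auto
  also have "\<dots> = ln 2 + ln y" using False by (simp add: ln_mult)
  also have "ln y = ln (y powr d) / d" using False assms by (simp add: ln_powr)
  also have "\<dots> \<le> (y powr d - 1) / d" using False assms by (intro divide_right_mono ln_le_minus_one) auto
  also have "ln (2::real) \<le> 1 / d" 
    using ln_le_minus_one[of "2::real"] mult_mono[of d 1 "ln 2" "1::real"] assms by (simp add: field_simps)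
  finally show ?thesis by (simp add: diff_divide_distrib)
qed

lemma ln_norm_divide_le:
  fixes u v :: complex
  assumes "0 < d" "d \<le> 1" "u \<noteq> 0" "v \<noteq> 0"
  shows "ln (norm (u / v)) \<le> norm (u - v) powr d / d * norm v powr -d"
proof -
  have "norm u \<le> norm v + norm (u - v)" using norm_triangle_sub by blast
  hence "norm (u / v) \<le> 1 + norm (u - v) / norm v"
    using assms by (simp add: norm_divide field_simps)
  hence "ln (norm (u / v)) \<le> ln (1 + norm (u - v) / norm v)"
    using assms by (intro ln_mono) (auto intro: add_pos_nonneg)
  also have "\<dots> \<le> (norm (u - v) / norm v) powr d / d"
    using assms by (intro ln_1_plus_le_powr) auto
  also have "\<dots> = norm (u - v) powr d / d * norm v powr -d"
    by (simp add: powr_divide powr_minus field_simps)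
  finally show ?thesis .
qed

text \<open>Swapping \<open>u\<close> and \<open>v\<close> changes the sign of the logarithm. The
  two-sided bound lets one estimate serve both a shift quotient and its reciprocal.\<close>

lemma abs_ln_norm_divide_le:
  fixes u v :: complex
  assumes "0 < d" "d \<le> 1" "u \<noteq> 0" "v \<noteq> 0"
  shows "\<bar>ln (norm (u / v))\<bar> \<le> norm (u - v) powr d / d * (norm u powr -d + norm v powr -d)"
proof -
  have "ln (norm (u / v)) \<le> norm (u - v) powr d / d * norm v powr -d"
    "ln (norm (v / u)) \<le> norm (u - v) powr d / d * norm u powr -d"
    using ln_norm_divide_le[of d u v] ln_norm_divide_le[of d v u] assms by (auto simp: norm_minus_commute)
  moreover have "ln (norm (v / u)) = - ln (norm (u / v))"
    using assms by (simp add: norm_divide ln_div)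
  moreover have "0 \<le> norm (u - v) powr d / d * norm v powr -d" "0 \<le> norm (u - v) powr d / d * norm u powr -d"
    using assms by auto
  ultimately show ?thesis by (simp add: distrib_left abs_le_iff)
qed

section \<open>Mean of the logarithmic distance to a point inside the circle\<close>

lemma rcis_diff_nonzero:
  assumes "norm a < R"
  shows "rcis R \<theta> - a \<noteq> 0"
proof
  assume "rcis R \<theta> - a = 0"
  hence "norm a = \<bar>R\<bar>" by (metis complex_mod_rcis right_minus_eq)
  thus False using assms by auto
qed

lemma continuous_on_ln_norm_rcis:
  assumes "norm a < R"
  shows "continuous_on A (\<lambda>\<theta>. ln (norm (rcis R \<theta> - a) / R))"
proof -
  have "R > 0" using assms by (smt (verit) norm_ge_zero)
  thus ?thesis
    using rcis_diff_nonzero[OF assms] by (intro continuous_intros) auto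
qed

text \<open>The scaled distance \<open>x\<close> is at most 2, so \<open>ln x \<le> 1\<close>, while
  \<open>- ln x \<le> 2 * x powr -(1/2)\<close>. The power integral with exponent 1/2 applies, and
  the powers of \<open>R\<close> cancel, which makes the bound independent of \<open>R\<close> and
  \<open>a\<close>.\<close>

lemma circle_integral_abs_ln_bound:
  obtains K where "K > 0"
    "\<And>R a. norm a < R \<Longrightarrow> integral {0..2*pi} (\<lambda>\<theta>. \<bar>ln (norm (rcis R \<theta> - a) / R)\<bar>) \<le> K"
proof -
  obtain K where K: "K > 0"
    "\<And>r w. r > 0 \<Longrightarrow> (\<lambda>\<theta>. norm (rcis r \<theta> - w) powr -(1/2)) integrable_on {0..2*pi}"
    "\<And>r w. r > 0 \<Longrightarrow> integral {0..2*pi} (\<lambda>\<theta>. norm (rcis r \<theta> - w) powr -(1/2)) \<le> K * r powr -(1/2)"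
    using circle_integral_powr_bound[of "1/2"] by auto
  have "integral {0..2*pi} (\<lambda>\<theta>. \<bar>ln (norm (rcis R \<theta> - a) / R)\<bar>) \<le> 2 * pi + 2 * K" if a: "norm a < R" for R a
  proof -
    have R: "R > 0" using a by (smt (verit) norm_ge_zero)
    let ?g = "\<lambda>\<theta>. 1 + 2 * R powr (1/2) * norm (rcis R \<theta> - a) powr -(1/2)"
    have "integral {0..2*pi} (\<lambda>\<theta>. \<bar>ln (norm (rcis R \<theta> - a) / R)\<bar>) \<le> integral {0..2*pi} ?g"
    proof (rule integral_le)
      show "(\<lambda>\<theta>. \<bar>ln (norm (rcis R \<theta> - a) / R)\<bar>) integrable_on {0..2*pi}"
        by (intro integrable_continuous_real continuous_on_rabs continuous_on_ln_norm_rcis a)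
      show "?g integrable_on {0..2*pi}"
        by (intro integrable_add integrable_on_mult_right K(2)[OF R] integrable_const_ivl)
      fix \<theta> :: real
      define x where "x = norm (rcis R \<theta> - a) / R"
      have x: "x > 0" using rcis_diff_nonzero[OF a] R by (simp add: x_def)
      have "norm (rcis R \<theta> - a) \<le> R + norm a" using norm_triangle_ineq4[of "rcis R \<theta>" a] R by simp
      hence x2: "x \<le> 2" using a R by (simp add: x_def field_simps)
      have "ln x \<le> 1" using ln_le_minus_one[OF x] x2 by simp
      moreover have "- ln x \<le> 2 * x powr -(1/2)"
      proof -
        have "- ln x = 2 * ln (x powr -(1/2))" using x by (simp add: ln_powr)
        also have "\<dots> \<le> 2 * x powr -(1/2)" using x by (intro mult_left_mono ln_bound) auto
        finally show ?thesis .
      qed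
      moreover have "0 \<le> 2 * x powr -(1/2)" by simp
      ultimately have "\<bar>ln x\<bar> \<le> 1 + 2 * x powr -(1/2)" by linarith
      also have "x powr -(1/2) = R powr (1/2) * norm (rcis R \<theta> - a) powr -(1/2)"
        unfolding x_def using R by (simp add: powr_divide powr_minus field_simps)
      finally show "\<bar>ln (norm (rcis R \<theta> - a) / R)\<bar> \<le> ?g \<theta>" by (simp add: x_def mult.assoc)
    qed
    also have "integral {0..2*pi} ?g = 2 * pi + 2 * R powr (1/2) * integral {0..2*pi} (\<lambda>\<theta>. norm (rcis R \<theta> - a) powr -(1/2))"
    proof (subst integral_add)
      show "(\<lambda>\<theta>. 2 * R powr (1/2) * norm (rcis R \<theta> - a) powr -(1/2)) integrable_on {0..2*pi}"
        by (intro integrable_on_mult_right K(2)[OF R])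
    qed auto
    also have "\<dots> \<le> 2 * pi + 2 * R powr (1/2) * (K * R powr -(1/2))"
      using K(3)[OF R, of a] by (intro add_left_mono mult_left_mono) auto
    also have "\<dots> = 2 * pi + 2 * K * (R powr (1/2) * R powr -(1/2))" by simp
    also have "R powr (1/2) * R powr -(1/2) = 1" using R by (simp flip: powr_add)
    finally show ?thesis by simp
  qed
  thus ?thesis using that[of "2 * pi + 2 * K"] K(1) by (simp add: add_pos_pos)
qed

subsection \<open>Holomorphic functions in a disc\<close>

text \<open>Cauchy's formula at the centre, with \<open>dz = \<i> z d\<theta>\<close> cancelling the
  denominator; the factor \<open>-\<i>\<close> removes the remaining unit.\<close>

lemma has_integral_circle_mean:
  fixes g :: "complex \<Rightarrow> complex"
  assumes "g holomorphic_on cball 0 R" "R > 0"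
  shows "((\<lambda>\<theta>. g (rcis R \<theta>)) has_integral (2 * pi * g 0)) {0..2*pi}"
proof -
  have "((\<lambda>u. g u / (u - 0)) has_contour_integral (2 * of_real pi * \<i> * g 0)) (part_circlepath 0 R 0 (2*pi))"
    using Cauchy_integral_circlepath_simple[OF assms(1), of 0] assms(2) by (simp add: circlepath_def)
  hence "((\<lambda>t. g (0 + R * cis t) / (0 + R * cis t - 0) * R * \<i> * cis t) has_integral (2 * of_real pi * \<i> * g 0)) {0..2*pi}"
    by (subst (asm) has_contour_integral_part_circlepath_iff) auto
  hence "((\<lambda>t. (-\<i>) * (g (0 + R * cis t) / (0 + R * cis t - 0) * R * \<i> * cis t)) has_integral (-\<i>) * (2 * of_real pi * \<i> * g 0)) {0..2*pi}"
    by (rule has_integral_mult_right)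
  moreover have "(-\<i>) * (g (0 + R * cis t) / (0 + R * cis t - 0) * R * \<i> * cis t) = g (rcis R t)" for t
    using assms(2) cis_neq_zero[of t] by (simp add: rcis_def field_simps)
  ultimately show ?thesis by (simp add: field_simps)
qed

text \<open>On \<open>|z| = R\<close>, \<open>z * cnj z = R^2\<close> gives
  \<open>|z - a| / R = |1 - cnj a * z / R^2|\<close>. The function on the right has positive real
  part in the closed disc and is 1 at the centre, so the mean value property of its logarithm gives
  0.\<close>

lemma has_integral_ln_norm_rcis:
  assumes "norm a < R"
  shows "((\<lambda>\<theta>. ln (norm (rcis R \<theta> - a) / R)) has_integral 0) {0..2*pi}"
proof -
  have R: "R > 0" using assms by (smt (verit) norm_ge_zero)
  define g where "g = (\<lambda>z. Ln (1 - cnj a * z / R ^ 2))"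
  have lt1: "norm (cnj a * z / R ^ 2) < 1" if "z \<in> cball 0 R" for z
  proof -
    have "norm a * norm z \<le> norm a * R" using that by (intro mult_left_mono) auto
    also have "\<dots> < R * R" using assms R by (intro mult_strict_right_mono) auto
    finally show ?thesis using R by (simp add: norm_mult norm_divide norm_power power2_eq_square)
  qed
  have nonpos: "1 - cnj a * z / R ^ 2 \<notin> \<real>\<^sub>\<le>\<^sub>0" if "z \<in> cball 0 R" for z
  proof
    assume *: "1 - cnj a * z / R ^ 2 \<in> \<real>\<^sub>\<le>\<^sub>0"
    hence "Re (1 - cnj a * z / R ^ 2) \<le> 0" by (auto simp: complex_nonpos_Reals_iff)
    hence "1 \<le> Re (cnj a * z / R ^ 2)" by simp
    also have "\<dots> \<le> norm (cnj a * z / R ^ 2)" by (rule complex_Re_le_cmod)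
    finally show False using lt1[OF that] by simp
  qed
  have "g holomorphic_on cball 0 R"
    unfolding g_def using R nonpos by (intro holomorphic_intros) auto
  hence "((\<lambda>\<theta>. g (rcis R \<theta>)) has_integral (2 * pi * g 0)) {0..2*pi}"
    using R by (rule has_integral_circle_mean)
  from has_integral_linear[OF this bounded_linear_Re]
  have "((\<lambda>\<theta>. Re (g (rcis R \<theta>))) has_integral 0) {0..2*pi}"
    by (simp add: o_def g_def)
  moreover have "Re (g (rcis R \<theta>)) = ln (norm (rcis R \<theta> - a) / R)" for \<theta>
  proof -
    let ?z = "rcis R \<theta>"
    have z: "?z \<in> cball 0 R" using R by simp
    have nz: "1 - cnj a * ?z / R ^ 2 \<noteq> 0" using nonpos[OF z] by auto
    have zz: "?z * cnj ?z = complex_of_real (R ^ 2)"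
      using R by (simp flip: complex_norm_square)
    have "1 - cnj a * ?z / R ^ 2 = (?z * cnj ?z - cnj a * ?z) / R ^ 2"
      unfolding zz using R by (simp add: field_simps)
    also have "\<dots> = ?z * cnj (?z - a) / R ^ 2" by (simp add: algebra_simps)
    also have "norm \<dots> = norm (?z - a) / R" 
      using R by (simp only: norm_mult norm_divide complex_mod_cnj) (simp add: power2_eq_square norm_mult)
    finally show ?thesis using nz by (simp add: g_def Re_Ln)
  qed
  ultimately show ?thesis by simp
qed

text \<open>
  With \<open>k(\<zeta>) = \<zeta> / (\<zeta> - z)\<^sup>2\<close>, Cauchy's formula gives \<open>2 \<pi> g'(z) = \<integral> g k\<close>, while on the circle
  \<open>g * cnj k\<close> agrees with a function that is holomorphic in the disc and vanishes at the centre,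
  whence \<open>\<integral> cnj g * k = 0\<close>. Adding up, only \<open>Re g\<close> enters.
\<close>
lemma norm_deriv_le_circle_integral_Re:
  assumes g: "g holomorphic_on cball 0 R" and z: "norm z < R"
  shows "norm (deriv g z) \<le> R / (pi * (R - norm z) ^ 2) * integral {0..2*pi} (\<lambda>\<theta>. \<bar>Re (g (rcis R \<theta>))\<bar>)"
proof -
  have R: "R > 0" using z by (smt (verit) norm_ge_zero)
  define k where "k = (\<lambda>\<zeta>::complex. \<zeta> / (\<zeta> - z) ^ 2)"
  have nz: "rcis R t \<noteq> z" for t using z by (metis complex_mod_rcis abs_of_pos R less_irrefl)
  have "((\<lambda>u. g u / (u - z) ^ (Suc 1)) has_contour_integral ((2 * pi * \<i>) / (fact 1) * (deriv ^^ 1) g z)) (part_circlepath 0 R 0 (2*pi))"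
    unfolding circlepath_def[symmetric]
    by (rule Cauchy_has_contour_integral_higher_derivative_circlepath)
       (use g z in \<open>auto intro: holomorphic_on_imp_continuous_on holomorphic_on_subset\<close>)
  hence "((\<lambda>t. g (0 + R * cis t) / (0 + R * cis t - z) ^ (Suc 1) * R * \<i> * cis t) has_integral ((2 * pi * \<i>) / (fact 1) * (deriv ^^ 1) g z)) {0..2*pi}"
    by (subst (asm) has_contour_integral_part_circlepath_iff) auto
  hence "((\<lambda>t. (-\<i>) * (g (0 + R * cis t) / (0 + R * cis t - z) ^ (Suc 1) * R * \<i> * cis t)) has_integral (-\<i>) * ((2 * pi * \<i>) / (fact 1) * (deriv ^^ 1) g z)) {0..2*pi}"
    by (rule has_integral_mult_right)
  moreover have "(-\<i>) * (g (0 + R * cis t) / (0 + R * cis t - z) ^ (Suc 1) * R * \<i> * cis t) = g (rcis R t) * k (rcis R t)" for t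
    by (simp add: rcis_def k_def power2_eq_square mult.commute[of _ "\<i>"] mult.left_commute[of _ "\<i>"]) 
       (simp add: mult_ac flip: mult.assoc[of "\<i>" "\<i>"])
  ultimately have 1: "((\<lambda>t. g (rcis R t) * k (rcis R t)) has_integral 2 * pi * deriv g z) {0..2*pi}"
    by (simp add: field_simps)
  \<comment> \<open>On the circle \<open>R^2 = \<zeta> * cnj \<zeta>\<close>, so the factor beside
    \<open>g \<zeta>\<close> is \<open>cnj (k \<zeta>)\<close>. Its denominator has no zero in the
    closed disc, and the factor \<open>\<zeta>\<close> makes \<open>F 0 = 0\<close>.\<close>
  define F where "F = (\<lambda>\<zeta>::complex. g \<zeta> * (\<zeta> * R ^ 2 / (R ^ 2 - cnj z * \<zeta>) ^ 2))"
  have nz2: "R ^ 2 - cnj z * \<zeta> \<noteq> 0" if "\<zeta> \<in> cball 0 R" for \<zeta> :: complex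
  proof
    assume "R ^ 2 - cnj z * \<zeta> = 0"
    hence "norm (cnj z * \<zeta>) = R ^ 2" using R by (metis abs_of_nonneg eq_iff_diff_eq_0 norm_of_real of_real_power zero_le_power2)
    moreover have "norm (cnj z * \<zeta>) \<le> norm z * R" using that by (auto simp: norm_mult intro: mult_left_mono)
    moreover have "norm z * R < R * R" using z R by simp
    ultimately show False by (simp add: power2_eq_square)
  qed
  have "F holomorphic_on cball 0 R"
    unfolding F_def using nz2 by (intro holomorphic_intros g) auto
  hence F0: "((\<lambda>\<theta>. F (rcis R \<theta>)) has_integral (2 * pi * F 0)) {0..2*pi}"
    using R by (rule has_integral_circle_mean)
  have "((\<lambda>\<theta>. cnj (F (rcis R \<theta>))) has_integral cnj 0) {0..2*pi}"
    using has_integral_linear[OF F0 bounded_linear_cnj] by (simp add: o_def F_def)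
  moreover have "cnj (F (rcis R \<theta>)) = cnj (g (rcis R \<theta>)) * k (rcis R \<theta>)" for \<theta>
  proof -
    let ?z = "rcis R \<theta>"
    have zz: "complex_of_real (R ^ 2) = ?z * cnj ?z"
      using R by (simp flip: complex_norm_square)
    have "?z \<noteq> 0" using R by simp
    have "?z * R ^ 2 / (R ^ 2 - cnj z * ?z) ^ 2 = ?z * (?z * cnj ?z) / (?z * cnj ?z - cnj z * ?z) ^ 2"
      by (simp flip: zz)
    also have "?z * cnj ?z - cnj z * ?z = ?z * cnj (?z - z)" by (simp add: algebra_simps)
    also have "?z * (?z * cnj ?z) / (?z * cnj (?z - z)) ^ 2 = cnj (k ?z)"
      using \<open>?z \<noteq> 0\<close> by (simp add: k_def power2_eq_square)
    finally have "F ?z = g ?z * cnj (k ?z)" by (simp add: F_def flip: times_divide_eq_right)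
    thus ?thesis by simp
  qed
  ultimately have 2: "((\<lambda>\<theta>. cnj (g (rcis R \<theta>)) * k (rcis R \<theta>)) has_integral 0) {0..2*pi}"
    by simp
  have "((\<lambda>\<theta>. g (rcis R \<theta>) * k (rcis R \<theta>) + cnj (g (rcis R \<theta>)) * k (rcis R \<theta>)) has_integral 2 * pi * deriv g z + 0) {0..2*pi}"
    by (rule has_integral_add[OF 1 2])
  moreover have "g w * c + cnj (g w) * c = of_real (2 * Re (g w)) * c" for w c
    by (metis complex_add_cnj distrib_right)
  ultimately have 3: "((\<lambda>\<theta>. of_real (2 * Re (g (rcis R \<theta>))) * k (rcis R \<theta>)) has_integral 2 * pi * deriv g z) {0..2*pi}"
    by simp
  have kb: "norm (k (rcis R \<theta>)) \<le> R / (R - norm z) ^ 2" for \<theta>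
  proof -
    have "R - norm z \<le> norm (rcis R \<theta> - z)" using norm_triangle_ineq2[of "rcis R \<theta>" z] R by simp
    thus ?thesis unfolding k_def using R z nz[of \<theta>]
      by (simp add: norm_divide norm_power) (intro divide_left_mono power_mono mult_pos_pos zero_less_power; simp)
  qed
  have cont: "continuous_on {0..2*pi} (\<lambda>\<theta>. g (rcis R \<theta>))"
    by (rule continuous_on_compose2[OF holomorphic_on_imp_continuous_on[OF g]]) (use R in \<open>auto intro!: continuous_intros\<close>)
  have "norm (2 * pi * deriv g z) = norm (integral {0..2*pi} (\<lambda>\<theta>. of_real (2 * Re (g (rcis R \<theta>))) * k (rcis R \<theta>)))"
    using 3 by (simp add: integral_unique)
  also have "\<dots> \<le> integral {0..2*pi} (\<lambda>\<theta>. 2 * R / (R - norm z) ^ 2 * \<bar>Re (g (rcis R \<theta>))\<bar>)"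
  proof (rule integral_norm_bound_integral)
    show "(\<lambda>\<theta>. of_real (2 * Re (g (rcis R \<theta>))) * k (rcis R \<theta>)) integrable_on {0..2*pi}" using 3 by blast
    show "(\<lambda>\<theta>. 2 * R / (R - norm z) ^ 2 * \<bar>Re (g (rcis R \<theta>))\<bar>) integrable_on {0..2*pi}"
      by (intro integrable_continuous_real continuous_intros cont)
    show "norm (of_real (2 * Re (g (rcis R x))) * k (rcis R x)) \<le> 2 * R / (R - norm z) ^ 2 * \<bar>Re (g (rcis R x))\<bar>" for x
      using mult_left_mono[OF kb[of x], of "\<bar>2 * Re (g (rcis R x))\<bar>"]
      by (simp add: norm_mult mult_ac del: of_real_mult)
  qed
  also have "\<dots> = 2 * R / (R - norm z) ^ 2 * integral {0..2*pi} (\<lambda>\<theta>. \<bar>Re (g (rcis R \<theta>))\<bar>)"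
    by simp
  finally have "2 * pi * norm (deriv g z) \<le> 2 * R / (R - norm z) ^ 2 * integral {0..2*pi} (\<lambda>\<theta>. \<bar>Re (g (rcis R \<theta>))\<bar>)"
    by (simp add: norm_mult)
  moreover have "(R - norm z) ^ 2 > 0" using z by simp
  ultimately show ?thesis by (simp add: field_simps)
qed

subsection \<open>Zeros, poles and factorization in a disc\<close>

text \<open>Using \<open>zorder\<close> makes the set insensitive to the values of \<open>f\<close>
  on sparse sets, so removable singularities and arbitrary values at poles cause no harm.\<close>

definition zeros_poles :: "(complex \<Rightarrow> complex) \<Rightarrow> complex set" where
  "zeros_poles f = {z. zorder f z \<noteq> 0}"

lemma eventually_nonzero_meromorphic_UNIV:
  assumes "f meromorphic_on UNIV" "\<not> (\<forall>\<^sub>F z in cosparse UNIV. f z = 0)"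
  shows "\<forall>\<^sub>F w in at z. f w \<noteq> 0"
proof -
  have "\<forall>\<^sub>F z in cosparse UNIV. f z \<noteq> 0"
    using meromorphic_imp_constant_or_avoid[OF assms(1), of 0] assms(2) by auto
  thus ?thesis by (rule eventually_cosparse_imp_eventually_at) auto
qed

lemma zeros_poles_sparse:
  assumes "f meromorphic_on UNIV" "\<not> (\<forall>\<^sub>F z in cosparse UNIV. f z = 0)"
  shows "zeros_poles f sparse_in UNIV"
proof -
  have "\<forall>\<^sub>F z in cosparse UNIV. f z \<noteq> 0"
    using meromorphic_imp_constant_or_avoid[OF assms(1), of 0] assms(2) by auto
  hence "\<forall>\<^sub>F z in cosparse UNIV. f analytic_on {z} \<and> f z \<noteq> 0"
    using meromorphic_on_imp_analytic_cosparse[OF assms(1)] by eventually_elim auto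
  hence "\<forall>\<^sub>F z in cosparse UNIV. \<not> z \<in> zeros_poles f"
    by eventually_elim (auto simp: zeros_poles_def zorder_eq_0I)
  thus ?thesis by (simp add: eventually_cosparse)
qed

lemma finite_zeros_poles_cball:
  assumes "f meromorphic_on UNIV" "\<not> (\<forall>\<^sub>F z in cosparse UNIV. f z = 0)"
  shows "finite (zeros_poles f \<inter> cball 0 R)"
  using sparse_in_compact_finite[OF sparse_in_subset[OF zeros_poles_sparse[OF assms]], of "cball 0 R"]
  by (simp add: Int_commute)

lemma is_pole_iff_zorder_neg:
  assumes "f meromorphic_on UNIV" "\<not> (\<forall>\<^sub>F z in cosparse UNIV. f z = 0)"
  shows "is_pole f z \<longleftrightarrow> zorder f z < 0"
proof
  have m: "f meromorphic_on {z}" using assms(1) by (rule meromorphic_on_subset) auto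
  show "zorder f z < 0" if "is_pole f z"
    using isolated_pole_imp_neg_zorder m that by (auto simp: meromorphic_at_iff)
  show "is_pole f z" if "zorder f z < 0"
    using zorder_neg_imp_is_pole[OF m eventually_nonzero_meromorphic_UNIV[OF assms] that] .
qed

lemma zorder_linear_divide:
  assumes "R > 0"
  shows "zorder (\<lambda>w. (w - a) / complex_of_real R) z = (if z = a then 1 else 0)"
proof (cases "z = a")
  case True
  have "zorder (\<lambda>w. (w - a) / complex_of_real R) z = 1"
    by (rule zorder_eqI[where S = UNIV and g = "\<lambda>_. 1 / complex_of_real R"]) (use assms True in auto)
  thus ?thesis using True by simp
next
  case False
  have "zorder (\<lambda>w. (w - a) / complex_of_real R) z = 0"
    by (rule zorder_eq_0I) (use assms False in \<open>auto intro!: analytic_intros\<close>)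
  thus ?thesis using False by simp
qed

text \<open>Dividing \<open>f\<close> by the product \<open>P\<close> of linear factors with the
  same orders leaves order 0 throughout the closed disc. After removal of singularities the quotient
  is holomorphic and zero-free there, so it has a logarithm.\<close>

lemma meromorphic_disc_factorization:
  assumes f: "f meromorphic_on UNIV" "\<not> (\<forall>\<^sub>F z in cosparse UNIV. f z = 0)" and R: "R > 0"
  defines "A \<equiv> zeros_poles f \<inter> cball 0 R"
  obtains g E where "g holomorphic_on cball 0 R" "finite E" "A \<subseteq> E"
    "\<And>z. z \<in> cball 0 R - E \<Longrightarrow> f z = (\<Prod>a\<in>A. ((z - a) / R) powi zorder f a) * exp (g z)"
proof -
  have finA: "finite A" unfolding A_def by (rule finite_zeros_poles_cball[OF f])
  define P where "P = (\<lambda>z. \<Prod>a\<in>A. ((z - a) / complex_of_real R) powi zorder f a)"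
  define F where "F = (\<lambda>z. f z / P z)"
  define h where "h = remove_sings F"
  have lin: "(\<lambda>w. (w - a) / complex_of_real R) meromorphic_on S" for a S
    by (intro meromorphic_on_divide meromorphic_on_diff meromorphic_on_id meromorphic_on_const)
  have Pm: "P meromorphic_on S" for S
    unfolding P_def by (rule meromorphic_on_prod, rule meromorphic_on_powi, rule lin)
  have Fm: "F meromorphic_on S" for S
    unfolding F_def using meromorphic_on_subset[OF f(1), of S] Pm by (intro meromorphic_on_divide) auto
  have P0: "P z \<noteq> 0" if "z \<notin> A" for z
    using that R finA by (auto simp: P_def power_int_eq_0_iff)
  have evA: "\<forall>\<^sub>F w in at z. w \<notin> A" for z
    using islimpt_finite[OF finA, of z] by (simp add: islimpt_conv_frequently_at frequently_def)
  have evP: "\<forall>\<^sub>F w in at z. P w \<noteq> 0" for z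
    using evA by eventually_elim (use P0 in auto)
  have evf: "\<forall>\<^sub>F w in at z. f w \<noteq> 0" for z
    by (rule eventually_nonzero_meromorphic_UNIV[OF f])
  have evF: "\<forall>\<^sub>F w in at z. F w \<noteq> 0" for z
    using evP evf by eventually_elim (auto simp: F_def)
  have zP: "zorder P z = (if z \<in> A then zorder f z else 0)" for z
  proof -
    have "zorder P z = (\<Sum>a\<in>A. zorder (\<lambda>w. ((w - a) / complex_of_real R) powi zorder f a) z)"
      unfolding P_def
      by (rule zorder_prod) (use evP lin in \<open>auto intro: meromorphic_on_powi simp: P_def\<close>)
    also have "\<dots> = (\<Sum>a\<in>A. if z = a then zorder f a else 0)"
    proof (rule sum.cong[OF refl])
      fix a
      have "\<forall>\<^sub>F w in at z. w \<noteq> a"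
        by (rule eventually_neq_at_within)
      hence "\<forall>\<^sub>F w in at z. (w - a) / complex_of_real R \<noteq> 0"
        by eventually_elim (use R in auto)
      hence fr: "\<exists>\<^sub>F w in at z. (w - a) / complex_of_real R \<noteq> 0"
        using eventually_frequently at_neq_bot by blast
      show "zorder (\<lambda>w. ((w - a) / complex_of_real R) powi zorder f a) z = (if z = a then zorder f a else 0)"
        by (subst zorder_power_int[OF lin fr]) (use R in \<open>simp add: zorder_linear_divide\<close>)
    qed
    also have "\<dots> = (if z \<in> A then zorder f z else 0)"
      using finA by simp
    finally show ?thesis .
  qed
  have iso: "isolated_singularity_at F z" "not_essential F z" for z
    using Fm[of "{z}"] by (auto simp: meromorphic_at_iff)
  \<comment> \<open>Order 0 rules out a pole, so the singularity of \<open>F\<close> is removable,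
    and it also rules out a zero of the extension.\<close>
  have hz: "h analytic_on {z} \<and> h z \<noteq> 0" if z: "z \<in> cball 0 R" for z
  proof -
    have "zorder F z = zorder f z - zorder P z"
      unfolding F_def
      by (rule zorder_divide) 
         (use meromorphic_on_subset[OF f(1), of "{z}"] Pm evP evf in \<open>auto intro: eventually_frequently\<close>)
    also have "\<dots> = 0" using zP[of z] z by (auto simp: A_def zeros_poles_def)
    finally have z0: "zorder F z = 0" .
    hence "\<not> is_pole F z" using isolated_pole_imp_neg_zorder[OF iso(1)[of z]] by auto
    then obtain c where "F \<midarrow>z\<rightarrow> c" using iso(2)[of z] by (auto simp: not_essential_def)
    hence ana: "h analytic_on {z}" unfolding h_def by (rule remove_sings_analytic_at[OF iso(1)])
    have "\<forall>\<^sub>F w in at z. h w = F w" unfolding h_def by (rule eventually_remove_sings_eq_at[OF iso(1)])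
    hence "\<forall>\<^sub>F w in at z. h w \<noteq> 0" using evF[of z] by eventually_elim auto
    hence "\<exists>\<^sub>F w in at z. h w \<noteq> 0" by (intro eventually_frequently) auto
    moreover have "zorder h z = 0" using z0 iso(1) by (simp add: h_def)
    ultimately show ?thesis using zorder_eq_0_iff[OF ana] ana by auto
  qed
  have "h analytic_on cball 0 R" using hz by (subst analytic_on_analytic_at) auto
  hence "h holomorphic_on cball 0 R" by (rule analytic_imp_holomorphic)
  then obtain g where g: "g holomorphic_on cball 0 R" "\<And>z. z \<in> cball 0 R \<Longrightarrow> h z = exp (g z)"
    by (rule contractible_imp_holomorphic_log) (use hz in \<open>auto intro: convex_imp_contractible\<close>)
  \<comment> \<open>Besides \<open>A\<close>, \<open>E\<close> collects the points where the value
    of \<open>F\<close> differs from that of its extension; sparseness in a compact disc makes them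
    finitely many.\<close>
  define E where "E = A \<union> (cball 0 R \<inter> {z. remove_sings F z \<noteq> F z})"
  have "{z. remove_sings F z \<noteq> F z} sparse_in cball 0 R"
    using eventually_remove_sings_eq[OF Fm] by (simp add: eventually_cosparse)
  hence "finite E" unfolding E_def using finA by (auto intro: sparse_in_compact_finite)
  moreover have "f z = (\<Prod>a\<in>A. ((z - a) / R) powi zorder f a) * exp (g z)" if "z \<in> cball 0 R - E" for z
  proof -
    have "F z = exp (g z)" using that g(2)[of z] by (auto simp: E_def h_def)
    moreover have "P z \<noteq> 0" using that by (intro P0) (auto simp: E_def)
    ultimately show ?thesis by (simp add: F_def P_def field_simps)
  qed
  moreover have "A \<subseteq> E" by (simp add: E_def)
  ultimately show ?thesis using that[OF g(1), of E] by blast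
qed

text \<open>The zeros and poles in \<open>cball 0 b\<close> have only finitely many moduli, which
  cannot fill an open interval.\<close>

lemma generic_radius:
  assumes f: "f meromorphic_on UNIV" "\<not> (\<forall>\<^sub>F z in cosparse UNIV. f z = 0)" and "a < b"
  obtains R where "a < R" "R < b" "\<And>z. z \<in> zeros_poles f \<Longrightarrow> norm z \<noteq> R"
proof -
  have "finite (norm ` (zeros_poles f \<inter> cball 0 b))" using finite_zeros_poles_cball[OF f] by auto
  hence "infinite ({a<..<b} - norm ` (zeros_poles f \<inter> cball 0 b))"
    using \<open>a < b\<close> by (simp add: infinite_Ioo Diff_infinite_finite)
  then obtain R where R: "R \<in> {a<..<b} - norm ` (zeros_poles f \<inter> cball 0 b)"
    using infinite_imp_nonempty by blast
  have "norm z \<noteq> R" if "z \<in> zeros_poles f" for z using R that by auto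
  thus ?thesis using that R by auto
qed

subsection \<open>Jensen's formula\<close>

text \<open>The contribution of a zero or pole at \<open>a\<close> to the integrated counting function, also at \<open>a = 0\<close>.\<close>
definition log_weight :: "real \<Rightarrow> complex \<Rightarrow> real" where
  "log_weight R a = ln (R / (if a = 0 then 1 else norm a))"

lemma log_weight_nonneg: "1 \<le> R \<Longrightarrow> norm a \<le> R \<Longrightarrow> 0 \<le> log_weight R a"
  by (auto simp: log_weight_def intro!: ln_ge_zero)

text \<open>The logarithm of the modulus of the leading Laurent coefficient at 0.\<close>
definition jensen_const :: "(complex \<Rightarrow> complex) \<Rightarrow> real" where
  "jensen_const f = Lim (at 0) (\<lambda>z. ln (norm (f z)) - zorder f 0 * ln (norm z))"

text \<open>In classical notation, \<open>n(R, f) + n(R, 1/f)\<close>.\<close>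

definition zero_pole_count :: "real \<Rightarrow> (complex \<Rightarrow> complex) \<Rightarrow> real" where
  "zero_pole_count R f = (\<Sum>a\<in>zeros_poles f \<inter> cball 0 R. \<bar>zorder f a\<bar>)"

lemma has_integral_step_divide:
  fixes b R :: real
  assumes "0 < b" "b \<le> R"
  shows "((\<lambda>t. (if b \<le> t then 1 else 0) / t) has_integral ln (R / b)) {0..R}"
proof -
  have "((\<lambda>t. 1 / t) has_integral (ln R - ln b)) {b..R}"
    by (rule fundamental_theorem_of_calculus)
       (use assms in \<open>auto intro!: derivative_eq_intros simp flip: has_real_derivative_iff_has_vector_derivative\<close>)
  hence "((\<lambda>t. if t \<in> {b..R} then 1 / t else 0) has_integral (ln R - ln b)) {0..R}"
    by (subst has_integral_restrict) (use assms in auto)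
  hence "((\<lambda>t. (if b \<le> t then 1 else 0) / t) has_integral (ln R - ln b)) {0..R}"
    by (rule has_integral_eq[rotated]) auto
  thus ?thesis using assms by (simp add: ln_div)
qed

context
  fixes f :: "complex \<Rightarrow> complex"
  assumes f: "f meromorphic_on UNIV" "\<not> (\<forall>\<^sub>F z in cosparse UNIV. f z = 0)"
begin

text \<open>The index set no longer depends on \<open>t\<close>, so the sum can be exchanged with
  the integral over \<open>t\<close>.\<close>

lemma pole_count_eq:
  assumes "t \<le> R"
  shows "pole_count t f = (\<Sum>a\<in>zeros_poles f \<inter> cball 0 R. if norm a \<le> t then nat (- zorder f a) else 0)"
proof -
  let ?A = "zeros_poles f \<inter> cball 0 R"
  have fin: "finite ?A" by (rule finite_zeros_poles_cball[OF f])
  have "pole_count t f = (\<Sum>a\<in>{z. norm z \<le> t \<and> is_pole f z}. if norm a \<le> t then nat (- zorder f a) else 0)"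
    unfolding pole_count_def by (rule sum.cong) auto
  also have "\<dots> = (\<Sum>a\<in>?A. if norm a \<le> t then nat (- zorder f a) else 0)"
    by (rule sum.mono_neutral_left[OF fin])
       (use assms in \<open>auto simp: zeros_poles_def is_pole_iff_zorder_neg[OF f]\<close>)
  finally show ?thesis .
qed

text \<open>A pole \<open>a\<close> away from the origin is counted from \<open>t = |a|\<close> on,
  and integrating \<open>1 / t\<close> from there gives \<open>ln (R / |a|)\<close>. A pole at the
  origin enters through the separate \<open>ln R\<close> term, and \<open>log_weight\<close> unites
  the two cases.\<close>

lemma integrated_pole_count_eq:
  assumes "R > 0"
  shows "integrated_pole_count R f =
    (\<Sum>a\<in>zeros_poles f \<inter> cball 0 R. real (nat (- zorder f a)) * log_weight R a)"
proof -
  let ?A = "zeros_poles f \<inter> cball 0 R"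
  let ?m = "\<lambda>a. real (nat (- zorder f a))"
  have fin: "finite ?A" by (rule finite_zeros_poles_cball[OF f])
  \<comment> \<open>Subtracting the indicator of \<open>a = 0\<close> cancels the contribution of
    the origin, whose \<open>1 / t\<close> would not be integrable near 0.\<close>
  have "((\<lambda>t. \<Sum>a\<in>?A. ?m a * (((if norm a \<le> t then 1 else 0) - (if a = 0 then 1 else 0)) / t)) has_integral
      (\<Sum>a\<in>?A. ?m a * (if a = 0 then 0 else log_weight R a))) {0..R}"
  proof (intro has_integral_sum fin has_integral_mult_right)
    fix a assume a: "a \<in> ?A"
    show "((\<lambda>t. ((if norm a \<le> t then 1 else 0) - (if a = 0 then 1 else 0)) / t) has_integral (if a = 0 then 0 else log_weight R a)) {0..R}"
    proof (cases "a = 0")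
      case True
      have "((\<lambda>t. 0) has_integral (0::real)) {0..R}" by simp
      thus ?thesis using True by (rule_tac has_integral_eq[rotated]) auto
    next
      case False
      thus ?thesis using has_integral_step_divide[of "norm a" R] a by (simp add: log_weight_def)
    qed
  qed
  hence "((\<lambda>t. (real (pole_count t f) - real (pole_count 0 f)) / t) has_integral
      (\<Sum>a\<in>?A. ?m a * (if a = 0 then 0 else log_weight R a))) {0..R}"
  proof (rule has_integral_eq[rotated])
    fix t assume t: "t \<in> {0..R}"
    have "(real (pole_count t f) - real (pole_count 0 f)) / t =
       ((\<Sum>a\<in>?A. real (if norm a \<le> t then nat (- zorder f a) else 0)) - (\<Sum>a\<in>?A. real (if norm a \<le> 0 then nat (- zorder f a) else 0))) / t"
      using t assms by (simp add: pole_count_eq[of _ R])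
    also have "\<dots> = (\<Sum>a\<in>?A. ?m a * (((if norm a \<le> t then 1 else 0) - (if a = 0 then 1 else 0)) / t))"
      unfolding sum_subtractf[symmetric] sum_divide_distrib by (rule sum.cong) (auto simp: field_simps)
    finally show "(\<Sum>a\<in>?A. ?m a * (((if norm a \<le> t then 1 else 0) - (if a = 0 then 1 else 0)) / t)) = (real (pole_count t f) - real (pole_count 0 f)) / t" ..
  qed
  hence "integrated_pole_count R f = (\<Sum>a\<in>?A. ?m a * (if a = 0 then 0 else log_weight R a)) + real (pole_count 0 f) * ln R"
    unfolding integrated_pole_count_def by (simp add: integral_unique)
  also have "real (pole_count 0 f) * ln R = (\<Sum>a\<in>?A. ?m a * (if a = 0 then log_weight R a else 0))"
    using assms by (auto simp: pole_count_eq[of 0 R] log_weight_def sum_distrib_right intro!: sum.cong)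
  also have "(\<Sum>a\<in>?A. ?m a * (if a = 0 then 0 else log_weight R a)) + \<dots> = (\<Sum>a\<in>?A. ?m a * log_weight R a)"
    unfolding sum.distrib[symmetric] by (rule sum.cong) auto
  finally show ?thesis .
qed

text \<open>Logarithms of moduli turn the product into a sum. Letting \<open>z\<close> tend to 0,
  after subtracting \<open>zorder f 0 * ln |z|\<close>, identifies \<open>Re (g 0)\<close>, since
  \<open>jensen_const\<close> is the limit of the same expression.\<close>

lemma log_disc_factorization:
  assumes R: "R > 0" and generic: "\<And>z. z \<in> zeros_poles f \<Longrightarrow> norm z \<noteq> R"
  defines "A \<equiv> zeros_poles f \<inter> cball 0 R"
  obtains g E where "g holomorphic_on cball 0 R" "finite E" "A \<subseteq> E"
    "\<And>z. z \<in> cball 0 R - E \<Longrightarrow> f z \<noteq> 0"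
    "\<And>z. z \<in> cball 0 R - E \<Longrightarrow> ln (norm (f z)) = (\<Sum>a\<in>A. zorder f a * ln (norm (z - a) / R)) + Re (g z)"
    "Re (g 0) = jensen_const f + (\<Sum>a\<in>A. zorder f a * log_weight R a)"
proof -
  have finA: "finite A" unfolding A_def by (rule finite_zeros_poles_cball[OF f])
  obtain g E where g: "g holomorphic_on cball 0 R" "finite E" "A \<subseteq> E"
    "\<And>z. z \<in> cball 0 R - E \<Longrightarrow> f z = (\<Prod>a\<in>A. ((z - a) / R) powi zorder f a) * exp (g z)"
    using meromorphic_disc_factorization[OF f R] unfolding A_def by metis
  have nz: "f z \<noteq> 0" if "z \<in> cball 0 R - E" for z
    using that g(3) R finA by (subst g(4)[OF that]) (auto simp: power_int_eq_0_iff)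
  have lnf: "ln (norm (f z)) = (\<Sum>a\<in>A. zorder f a * ln (norm (z - a) / R)) + Re (g z)"
    if z: "z \<in> cball 0 R - E" for z
  proof -
    have za: "z - a \<noteq> 0" if "a \<in> A" for a using that z g(3) by auto
    have "norm (f z) = (\<Prod>a\<in>A. (norm (z - a) / R) powi zorder f a) * exp (Re (g z))"
      unfolding g(4)[OF z] using R by (simp add: norm_mult prod_norm[symmetric] norm_power_int norm_divide)
    moreover have "(\<Prod>a\<in>A. (norm (z - a) / R) powi zorder f a) > 0"
      using za R by (intro prod_pos zero_less_power_int divide_pos_pos) auto
    ultimately have "ln (norm (f z)) = ln (\<Prod>a\<in>A. (norm (z - a) / R) powi zorder f a) + Re (g z)"
      by (simp add: ln_mult)
    also have "ln (\<Prod>a\<in>A. (norm (z - a) / R) powi zorder f a) = (\<Sum>a\<in>A. ln ((norm (z - a) / R) powi zorder f a))"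
      using za R finA by (intro ln_prod) auto
    also have "\<dots> = (\<Sum>a\<in>A. zorder f a * ln (norm (z - a) / R))"
      using za R by (intro sum.cong refl) (simp add: powr_real_of_int'[symmetric] ln_powr)
    finally show ?thesis .
  qed
  \<comment> \<open>Moving \<open>zorder f 0 * ln |z|\<close> into the sum pairs it with the factor
    at \<open>a = 0\<close>, where only \<open>- ln R\<close> remains; all other factors are
    continuous at 0.\<close>
  have "((\<lambda>z. (\<Sum>a\<in>A. zorder f a * (ln (norm (z - a) / R) - (if a = 0 then ln (norm z) else 0))) + Re (g z))
      \<longlongrightarrow> (\<Sum>a\<in>A. zorder f a * (- log_weight R a)) + Re (g 0)) (at 0)"
  proof (intro tendsto_intros)
    fix a
    show "((\<lambda>z. ln (norm (z - a) / R) - (if a = 0 then ln (norm z) else 0)) \<longlongrightarrow> - log_weight R a) (at 0)"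
    proof (cases "a = 0")
      case True
      have "\<forall>\<^sub>F z::complex in at 0. z \<noteq> 0" by (rule eventually_neq_at_within)
      hence "\<forall>\<^sub>F z in at 0. ln (norm (z - a) / R) - (if a = 0 then ln (norm z) else 0) = - log_weight R a"
        by eventually_elim (use True R in \<open>simp add: log_weight_def ln_div\<close>)
      thus ?thesis by (rule tendsto_eventually)
    next
      case False
      have "((\<lambda>z. ln (norm (z - a) / R)) \<longlongrightarrow> ln (norm (0 - a) / R)) (at 0)"
        using False R by (intro tendsto_intros) auto
      thus ?thesis using False R by (simp add: log_weight_def ln_div)
    qed
  next
    have "continuous_on (ball 0 R) g"
      using g(1) by (meson ball_subset_cball continuous_on_subset holomorphic_on_imp_continuous_on)
    hence "isCont g 0" using R by (simp add: continuous_on_eq_continuous_at)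
    thus "(g \<longlongrightarrow> g 0) (at 0)" by (simp add: isCont_def)
  qed
  moreover have "\<forall>\<^sub>F z in at 0. z \<in> cball 0 R - E"
  proof -
    have "\<forall>\<^sub>F z in at 0. z \<notin> E"
      using islimpt_finite[OF g(2), of 0] by (simp add: islimpt_conv_frequently_at frequently_def)
    moreover have "\<forall>\<^sub>F z in at 0. z \<in> ball 0 R"
      using R by (intro eventually_at_in_open') auto
    ultimately show ?thesis by eventually_elim auto
  qed
  hence "\<forall>\<^sub>F z in at 0. (\<Sum>a\<in>A. zorder f a * (ln (norm (z - a) / R) - (if a = 0 then ln (norm z) else 0))) + Re (g z)
     = ln (norm (f z)) - zorder f 0 * ln (norm z)"
  proof eventually_elim
    case (elim z)
    have "(\<Sum>a\<in>A. zorder f a * (if a = 0 then ln (norm z) else 0)) = (\<Sum>a\<in>A. if a = 0 then zorder f 0 * ln (norm z) else 0)"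
      by (rule sum.cong) auto
    \<comment> \<open>If 0 is not in \<open>A\<close>, then \<open>zorder f 0 = 0\<close> and both
      sides vanish.\<close>
    also have "\<dots> = zorder f 0 * ln (norm z)"
      using finA R by (auto simp: A_def zeros_poles_def)
    finally show ?case unfolding lnf[OF elim] by (simp add: right_diff_distrib sum_subtractf)
  qed
  ultimately have "((\<lambda>z. ln (norm (f z)) - zorder f 0 * ln (norm z)) \<longlongrightarrow> (\<Sum>a\<in>A. zorder f a * (- log_weight R a)) + Re (g 0)) (at 0)"
    by (rule Lim_transform_eventually)
  hence "jensen_const f = (\<Sum>a\<in>A. zorder f a * (- log_weight R a)) + Re (g 0)"
    unfolding jensen_const_def by (intro tendsto_Lim) auto
  hence "Re (g 0) = jensen_const f + (\<Sum>a\<in>A. zorder f a * log_weight R a)"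
    by (simp add: sum_negf)
  thus ?thesis using that[OF g(1-3) nz lnf] by blast
qed

end

section \<open>Bounds in a disc by the characteristic\<close>

lemma log_plus_nonneg: "0 \<le> log_plus x"
  by (simp add: log_plus_def)

lemma proximity_nonneg: "0 \<le> proximity r g"
proof (cases "(\<lambda>\<theta>. log_plus (norm (g (rcis r \<theta>)))) integrable_on {0..2*pi}")
  case True
  thus ?thesis unfolding proximity_def by (intro mult_nonneg_nonneg integral_nonneg) (auto simp: log_plus_nonneg)
qed (simp add: proximity_def not_integrable_integral)

context
  fixes f :: "complex \<Rightarrow> complex"
  assumes f: "f meromorphic_on UNIV" "\<not> (\<forall>\<^sub>F z in cosparse UNIV. f z = 0)"
begin

lemma zero_pole_count_nonneg: "0 \<le> zero_pole_count R f"
  unfolding zero_pole_count_def by (simp add: sum_nonneg)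

text \<open>
  Radii without zeros and poles on the circle suffice, since \<open>R\<close> can be chosen freely in an interval;
  this avoids the logarithmic singularities of \<open>f\<close> on the circle in Jensen's formula.
\<close>
lemma characteristic_controls_disc:
  obtains K where "K > 0"
    "\<And>R. 1 \<le> R \<Longrightarrow> (\<And>z. z \<in> zeros_poles f \<Longrightarrow> norm z \<noteq> R) \<Longrightarrow>
      (\<Sum>a\<in>zeros_poles f \<inter> cball 0 R. \<bar>zorder f a\<bar> * log_weight R a) \<le> 2 * characteristic R f + \<bar>jensen_const f\<bar> \<and>
      (\<exists>g E. g holomorphic_on cball 0 R \<and> finite E \<and> zeros_poles f \<inter> cball 0 R \<subseteq> E \<and>
        (\<forall>z \<in> cball 0 R - E. f z \<noteq> 0 \<and>
           ln (norm (f z)) = (\<Sum>a\<in>zeros_poles f \<inter> cball 0 R. zorder f a * ln (norm (z - a) / R)) + Re (g z)) \<and>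
        integral {0..2*pi} (\<lambda>\<theta>. \<bar>Re (g (rcis R \<theta>))\<bar>)
          \<le> 2 * pi * (2 * characteristic R f + \<bar>jensen_const f\<bar>) + K * zero_pole_count R f)"
proof -
  obtain K where K: "K > 0"
    "\<And>R a. norm a < R \<Longrightarrow> integral {0..2*pi} (\<lambda>\<theta>. \<bar>ln (norm (rcis R \<theta> - a) / R)\<bar>) \<le> K"
    using circle_integral_abs_ln_bound by blast
  show ?thesis
  proof (rule that[OF K(1)])
    fix R :: real
    assume R1: "1 \<le> R" and generic: "\<And>z. z \<in> zeros_poles f \<Longrightarrow> norm z \<noteq> R"
    have R: "R > 0" using R1 by simp
    define A where "A = zeros_poles f \<inter> cball 0 R"
    have finA: "finite A" unfolding A_def by (rule finite_zeros_poles_cball[OF f])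
    have A: "norm a < R" if "a \<in> A" for a using that generic[of a] by (auto simp: A_def less_le)
    define J where "J = jensen_const f"
    define T where "T = characteristic R f"
    obtain g E where g: "g holomorphic_on cball 0 R" "finite E" "A \<subseteq> E"
      "\<And>z. z \<in> cball 0 R - E \<Longrightarrow> f z \<noteq> 0"
      "\<And>z. z \<in> cball 0 R - E \<Longrightarrow> ln (norm (f z)) = (\<Sum>a\<in>A. zorder f a * ln (norm (z - a) / R)) + Re (g z)"
      "Re (g 0) = J + (\<Sum>a\<in>A. zorder f a * log_weight R a)"
      using log_disc_factorization[OF f R generic] unfolding A_def J_def by blast
    define X where "X = {\<theta> \<in> {0..2*pi}. rcis R \<theta> \<in> E}"
    have finX: "finite X" unfolding X_def by (rule finite_rcis_vimage[OF R g(2)])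
    define S where "S = (\<lambda>\<theta>. \<Sum>a\<in>A. zorder f a * ln (norm (rcis R \<theta> - a) / R))"
    define l where "l = (\<lambda>\<theta>. S \<theta> + Re (g (rcis R \<theta>)))"
    have lnf: "ln (norm (f (rcis R \<theta>))) = l \<theta>" "f (rcis R \<theta>) \<noteq> 0" if "\<theta> \<in> {0..2*pi} - X" for \<theta>
      using that R by (auto simp: l_def S_def X_def intro!: g(4,5))
    have contg: "continuous_on {0..2*pi} (\<lambda>\<theta>. g (rcis R \<theta>))"
      by (rule continuous_on_compose2[OF holomorphic_on_imp_continuous_on[OF g(1)]]) (use R in \<open>auto intro!: continuous_intros\<close>)
    have contln: "continuous_on {0..2*pi} (\<lambda>\<theta>. ln (norm (rcis R \<theta> - a) / R))" if "a \<in> A" for a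
      by (rule continuous_on_ln_norm_rcis[OF A[OF that]])
    have contS: "continuous_on {0..2*pi} S"
      unfolding S_def by (intro continuous_intros contln)
    have contl: "continuous_on {0..2*pi} l"
      unfolding l_def by (intro continuous_intros contg contS)
    have p1: "proximity R f = 1 / (2 * pi) * integral {0..2*pi} (\<lambda>\<theta>. max 0 (l \<theta>))"
      unfolding proximity_def
      by (intro arg_cong2[of _ _ _ _ "(*)"] refl integral_spike[of X]) (use finX lnf in \<open>auto simp: log_plus_def\<close>)
    \<comment> \<open>Off finitely many angles \<open>l\<close> is \<open>ln |f|\<close>, so
      \<open>p2\<close> is the proximity function of \<open>1/f\<close>.\<close>
    define p2 where "p2 = 1 / (2 * pi) * integral {0..2*pi} (\<lambda>\<theta>. max 0 (- l \<theta>))"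
    have int1: "(\<lambda>\<theta>. max 0 (l \<theta>)) integrable_on {0..2*pi}" "(\<lambda>\<theta>. max 0 (- l \<theta>)) integrable_on {0..2*pi}"
      by (intro integrable_continuous_real continuous_intros contl)+
    have p2_nonneg: "p2 \<ge> 0" unfolding p2_def by (intro mult_nonneg_nonneg integral_nonneg int1) auto
    \<comment> \<open>The linear factors have mean 0 on the circle and \<open>Re g\<close> has mean
      \<open>Re (g 0)\<close>; this is Jensen's formula.\<close>
    have "(S has_integral (\<Sum>a\<in>A. real_of_int (zorder f a) * 0)) {0..2*pi}"
      unfolding S_def by (intro has_integral_sum finA has_integral_mult_right has_integral_ln_norm_rcis A)
    moreover have "((\<lambda>\<theta>. Re (g (rcis R \<theta>))) has_integral Re (2 * pi * g 0)) {0..2*pi}"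
      using has_integral_linear[OF has_integral_circle_mean[OF g(1) R] bounded_linear_Re] by (simp add: o_def)
    ultimately have "(l has_integral (\<Sum>a\<in>A. real_of_int (zorder f a) * 0) + Re (2 * pi * g 0)) {0..2*pi}"
      unfolding l_def by (rule has_integral_add)
    hence "integral {0..2*pi} l = 2 * pi * Re (g 0)" by (simp add: integral_unique)
    moreover have "integral {0..2*pi} (\<lambda>\<theta>. max 0 (l \<theta>)) - integral {0..2*pi} (\<lambda>\<theta>. max 0 (- l \<theta>)) = integral {0..2*pi} l"
      by (subst integral_diff[symmetric, OF int1]) (auto intro!: integral_cong)
    ultimately have jensen: "proximity R f - p2 = Re (g 0)"
      unfolding p1 p2_def by (simp add: field_simps)
    have "integral {0..2*pi} (\<lambda>\<theta>. \<bar>l \<theta>\<bar>) = integral {0..2*pi} (\<lambda>\<theta>. max 0 (l \<theta>)) + integral {0..2*pi} (\<lambda>\<theta>. max 0 (- l \<theta>))"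
      by (subst integral_add[symmetric, OF int1]) (auto intro!: integral_cong)
    hence absl: "integral {0..2*pi} (\<lambda>\<theta>. \<bar>l \<theta>\<bar>) = 2 * pi * (proximity R f + p2)"
      unfolding p1 p2_def by (simp add: field_simps)
    define N where "N = (\<Sum>a\<in>A. real (nat (- zorder f a)) * log_weight R a)"
    define Z where "Z = (\<Sum>a\<in>A. real (nat (zorder f a)) * log_weight R a)"
    have wt: "log_weight R a \<ge> 0" if "a \<in> A" for a
      using R1 A[OF that] by (intro log_weight_nonneg) auto
    have NZ0: "N \<ge> 0" "Z \<ge> 0" unfolding N_def Z_def by (auto intro!: sum_nonneg mult_nonneg_nonneg wt)
    have "Z - N = (\<Sum>a\<in>A. zorder f a * log_weight R a)"
      unfolding N_def Z_def sum_subtractf[symmetric] left_diff_distrib[symmetric] 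
      by (rule sum.cong) auto
    \<comment> \<open>First fundamental theorem: \<open>p2 + Z\<close> is the characteristic of
      \<open>1/f\<close>, which differs from that of \<open>f\<close> by the constant
      \<open>J\<close>.\<close>
    hence "p2 + Z = T - J" and TN: "T = proximity R f + N"
      using jensen g(6) integrated_pole_count_eq[OF f R] by (auto simp: T_def characteristic_def N_def A_def)
    \<comment> \<open>The four quantities are nonnegative and sum to \<open>2 * T - J\<close>, so
      any two of them are bounded by it.\<close>
    hence b: "proximity R f + p2 \<le> 2 * T + \<bar>J\<bar>" "N + Z \<le> 2 * T + \<bar>J\<bar>"
      using NZ0 p2_nonneg proximity_nonneg[of R f] by auto
    have "(\<Sum>a\<in>A. \<bar>zorder f a\<bar> * log_weight R a) = N + Z"
      unfolding N_def Z_def sum.distrib[symmetric] distrib_right[symmetric] 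
      by (rule sum.cong) auto
    hence 1: "(\<Sum>a\<in>A. \<bar>zorder f a\<bar> * log_weight R a) \<le> 2 * T + \<bar>J\<bar>" using b by simp
    \<comment> \<open>Here \<open>Re g = l - S\<close>: the mean of \<open>|l|\<close> is controlled
      by \<open>T\<close> and \<open>J\<close>, and each logarithm in \<open>S\<close> by the
      uniform constant \<open>K\<close>.\<close>
    have "integral {0..2*pi} (\<lambda>\<theta>. \<bar>Re (g (rcis R \<theta>))\<bar>) \<le> 
        integral {0..2*pi} (\<lambda>\<theta>. \<bar>l \<theta>\<bar> + (\<Sum>a\<in>A. \<bar>zorder f a\<bar> * \<bar>ln (norm (rcis R \<theta> - a) / R)\<bar>))"
    proof (rule integral_le)
      fix \<theta> :: real
      have "\<bar>S \<theta>\<bar> \<le> (\<Sum>a\<in>A. \<bar>zorder f a\<bar> * \<bar>ln (norm (rcis R \<theta> - a) / R)\<bar>)"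
        unfolding S_def by (rule order.trans[OF sum_abs]) (simp add: abs_mult)
      thus "\<bar>Re (g (rcis R \<theta>))\<bar> \<le> \<bar>l \<theta>\<bar> + (\<Sum>a\<in>A. \<bar>zorder f a\<bar> * \<bar>ln (norm (rcis R \<theta> - a) / R)\<bar>)"
        by (simp add: l_def)
    qed (intro integrable_continuous_real continuous_intros contln contl contg; assumption)+
    also have "\<dots> = 2 * pi * (proximity R f + p2) + (\<Sum>a\<in>A. \<bar>zorder f a\<bar> * integral {0..2*pi} (\<lambda>\<theta>. \<bar>ln (norm (rcis R \<theta> - a) / R)\<bar>))"
    proof (subst integral_add)
      show "(\<lambda>\<theta>. \<bar>l \<theta>\<bar>) integrable_on {0..2*pi}"
        by (intro integrable_continuous_real continuous_intros contl)
      show "(\<lambda>\<theta>. \<Sum>a\<in>A. \<bar>zorder f a\<bar> * \<bar>ln (norm (rcis R \<theta> - a) / R)\<bar>) integrable_on {0..2*pi}"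
        by (intro integrable_continuous_real continuous_intros contln)
      show "integral {0..2*pi} (\<lambda>\<theta>. \<bar>l \<theta>\<bar>) + integral {0..2*pi} (\<lambda>\<theta>. \<Sum>a\<in>A. \<bar>zorder f a\<bar> * \<bar>ln (norm (rcis R \<theta> - a) / R)\<bar>)
        = 2 * pi * (proximity R f + p2) + (\<Sum>a\<in>A. \<bar>zorder f a\<bar> * integral {0..2*pi} (\<lambda>\<theta>. \<bar>ln (norm (rcis R \<theta> - a) / R)\<bar>))"
        unfolding absl
        by (subst integral_sum[OF finA]) (auto intro!: integrable_continuous_real continuous_intros contln)
    qed
    also have "\<dots> \<le> 2 * pi * (2 * T + \<bar>J\<bar>) + (\<Sum>a\<in>A. \<bar>zorder f a\<bar> * K)"
      by (rule add_mono; (rule sum_mono)?; rule mult_left_mono) (use b(1) K(2)[OF A] in auto)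
    also have "(\<Sum>a\<in>A. \<bar>zorder f a\<bar> * K) = K * zero_pole_count R f"
      by (simp add: zero_pole_count_def A_def sum_distrib_left mult.commute)
    finally have 2: "integral {0..2*pi} (\<lambda>\<theta>. \<bar>Re (g (rcis R \<theta>))\<bar>) \<le> 2 * pi * (2 * T + \<bar>J\<bar>) + K * zero_pole_count R f" .
    show "(\<Sum>a\<in>zeros_poles f \<inter> cball 0 R. \<bar>zorder f a\<bar> * log_weight R a) \<le> 2 * characteristic R f + \<bar>jensen_const f\<bar> \<and>
      (\<exists>g E. g holomorphic_on cball 0 R \<and> finite E \<and> zeros_poles f \<inter> cball 0 R \<subseteq> E \<and>
        (\<forall>z \<in> cball 0 R - E. f z \<noteq> 0 \<and>
           ln (norm (f z)) = (\<Sum>a\<in>zeros_poles f \<inter> cball 0 R. zorder f a * ln (norm (z - a) / R)) + Re (g z)) \<and>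
        integral {0..2*pi} (\<lambda>\<theta>. \<bar>Re (g (rcis R \<theta>))\<bar>)
          \<le> 2 * pi * (2 * characteristic R f + \<bar>jensen_const f\<bar>) + K * zero_pole_count R f)"
      using 1 2 g(1-5) unfolding A_def T_def J_def by blast
  qed
qed

text \<open>Every point counted in the smaller disc has weight at least \<open>ln c\<close> in the
  larger one. The assumption \<open>c \<le> R'\<close> serves the origin, whose weight is
  \<open>ln R'\<close>.\<close>

lemma zero_pole_count_le_characteristic:
  assumes "1 < c" "c \<le> R'" "c * R \<le> R'" "0 < R"
    and generic: "\<And>z. z \<in> zeros_poles f \<Longrightarrow> norm z \<noteq> R'"
  shows "zero_pole_count R f * ln c \<le> 2 * characteristic R' f + \<bar>jensen_const f\<bar>"
proof -
  have "1 * R < c * R" using assms by (intro mult_strict_right_mono) auto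
  hence RR: "R < R'" using assms by linarith
  have "zero_pole_count R f * ln c = (\<Sum>a\<in>zeros_poles f \<inter> cball 0 R. \<bar>zorder f a\<bar> * ln c)"
    by (simp add: zero_pole_count_def sum_distrib_right)
  also have "\<dots> \<le> (\<Sum>a\<in>zeros_poles f \<inter> cball 0 R. \<bar>zorder f a\<bar> * log_weight R' a)"
  proof (intro sum_mono mult_left_mono)
    fix a assume a: "a \<in> zeros_poles f \<inter> cball 0 R"
    have "c \<le> R' / (if a = 0 then 1 else norm a)"
    proof (cases "a = 0")
      case False
      have "c * norm a \<le> c * R" using a assms by (intro mult_left_mono) auto
      hence "c * norm a \<le> R'" using assms by linarith
      thus ?thesis using False by (simp add: field_simps)
    qed (use assms in auto)
    thus "ln c \<le> log_weight R' a" unfolding log_weight_def using assms by (intro ln_mono) auto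
  qed auto
  also have "\<dots> \<le> (\<Sum>a\<in>zeros_poles f \<inter> cball 0 R'. \<bar>zorder f a\<bar> * log_weight R' a)"
    by (rule sum_mono2) (use RR assms finite_zeros_poles_cball[OF f] in \<open>auto intro!: mult_nonneg_nonneg log_weight_nonneg\<close>)
  also have "\<dots> \<le> 2 * characteristic R' f + \<bar>jensen_const f\<bar>"
  proof (rule characteristic_controls_disc, goal_cases)
    case (1 K)
    have "1 \<le> R'" using assms by linarith
    from 1(2)[OF this generic] show ?case by (rule conjunct1)
  qed
  finally show ?thesis .
qed

end

subsection \<open>Shift quotients\<close>

context
  fixes f :: "complex \<Rightarrow> complex"
  assumes f: "f meromorphic_on UNIV" "\<not> (\<forall>\<^sub>F z in cosparse UNIV. f z = 0)"
begin

text \<open>With \<open>4 * r \<le> R\<close> and \<open>norm w \<le> r\<close>, both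
  \<open>z\<close> and \<open>z + w\<close> stay in the disc of radius
  \<open>2 * r \<le> R / 2\<close>, well away from the circle of factorization. A single majorant
  \<open>D\<close> of \<open>|ln |f(z + w)| - ln |f z||\<close> serves both quotients.\<close>

lemma proximity_shift_quotient_le:
  assumes d: "0 < d" "d < 1"
  obtains K where "K > 0"
    "\<And>r R w. 0 < r \<Longrightarrow> 1 \<le> R \<Longrightarrow> 4 * r \<le> R \<Longrightarrow> (\<And>z. z \<in> zeros_poles f \<Longrightarrow> norm z \<noteq> R) \<Longrightarrow> norm w \<le> r \<Longrightarrow>
      proximity r (\<lambda>z. f (z + w) / f z) + proximity r (\<lambda>z. f z / f (z + w))
        \<le> K * (zero_pole_count R f * (norm w / r) powr d
             + norm w / R * (2 * characteristic R f + \<bar>jensen_const f\<bar> + zero_pole_count R f))"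
proof -
  obtain K where K: "K > 0"
    "\<And>r w. r > 0 \<Longrightarrow> (\<lambda>\<theta>. norm (rcis r \<theta> - w) powr -d) integrable_on {0..2*pi}"
    "\<And>r w. r > 0 \<Longrightarrow> integral {0..2*pi} (\<lambda>\<theta>. norm (rcis r \<theta> - w) powr -d) \<le> K * r powr -d"
    using circle_integral_powr_bound[OF d] by metis
  obtain L where L: "L > 0"
    "\<And>R. 1 \<le> R \<Longrightarrow> (\<And>z. z \<in> zeros_poles f \<Longrightarrow> norm z \<noteq> R) \<Longrightarrow>
      (\<exists>g E. g holomorphic_on cball 0 R \<and> finite E \<and> zeros_poles f \<inter> cball 0 R \<subseteq> E \<and>
        (\<forall>z \<in> cball 0 R - E. f z \<noteq> 0 \<and>
           ln (norm (f z)) = (\<Sum>a\<in>zeros_poles f \<inter> cball 0 R. zorder f a * ln (norm (z - a) / R)) + Re (g z)) \<and>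
        integral {0..2*pi} (\<lambda>\<theta>. \<bar>Re (g (rcis R \<theta>))\<bar>)
          \<le> 2 * pi * (2 * characteristic R f + \<bar>jensen_const f\<bar>) + L * zero_pole_count R f)"
    "\<And>R. 1 \<le> R \<Longrightarrow> (\<And>z. z \<in> zeros_poles f \<Longrightarrow> norm z \<noteq> R) \<Longrightarrow>
      (\<Sum>a\<in>zeros_poles f \<inter> cball 0 R. \<bar>zorder f a\<bar> * log_weight R a) \<le> 2 * characteristic R f + \<bar>jensen_const f\<bar>"
    by (rule characteristic_controls_disc[OF f]) blast
  \<comment> \<open>Two proximity functions, each with factor \<open>1 / (2 * pi)\<close>, give
    \<open>1 / pi\<close>. \<open>C1\<close> collects two singular integrals per zero or pole;
    \<open>C2\<close> comes from \<open>2 * B * norm w\<close> and the bound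
    \<open>(2 * pi + L) * (T + n)\<close> for \<open>M\<close>.\<close>
  define C1 where "C1 = 2 * K / (pi * d)"
  define C2 where "C2 = 8 * (2 * pi + L) / pi"
  have C: "C1 > 0" "C2 > 0" using K(1) L(1) d by (simp_all add: C1_def C2_def add_pos_pos)
  show ?thesis
  proof (rule that[of "C1 + C2"])
    fix r R :: real and w :: complex
    assume r: "0 < r" and R1: "1 \<le> R" and rR: "4 * r \<le> R"
      and generic: "\<And>z. z \<in> zeros_poles f \<Longrightarrow> norm z \<noteq> R" and w: "norm w \<le> r"
    define A where "A = zeros_poles f \<inter> cball 0 R"
    have finA: "finite A" unfolding A_def by (rule finite_zeros_poles_cball[OF f])
    define T where "T = 2 * characteristic R f + \<bar>jensen_const f\<bar>"
    define n where "n = zero_pole_count R f"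
    obtain g E where g: "g holomorphic_on cball 0 R" "finite E" "A \<subseteq> E"
      "\<And>z. z \<in> cball 0 R - E \<Longrightarrow> f z \<noteq> 0"
      "\<And>z. z \<in> cball 0 R - E \<Longrightarrow> ln (norm (f z)) = (\<Sum>a\<in>A. zorder f a * ln (norm (z - a) / R)) + Re (g z)"
      "integral {0..2*pi} (\<lambda>\<theta>. \<bar>Re (g (rcis R \<theta>))\<bar>) \<le> 2 * pi * T + L * n"
      using L(2)[OF R1 generic] unfolding A_def T_def n_def by blast
    define M where "M = integral {0..2*pi} (\<lambda>\<theta>. \<bar>Re (g (rcis R \<theta>))\<bar>)"
    \<comment> \<open>For \<open>norm z \<le> R / 2\<close> the kernel factor
      \<open>R / (pi * (R - norm z)^2)\<close> is at most \<open>4 / (pi * R)\<close>.\<close>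
    define B where "B = 4 / (pi * R) * M"
    have n0: "n \<ge> 0" unfolding n_def by (rule zero_pole_count_nonneg[OF f])
    \<comment> \<open>Nonnegativity of \<open>T\<close> is read off from the nonnegative weighted
      count that it dominates.\<close>
    have "0 \<le> (\<Sum>a\<in>A. \<bar>zorder f a\<bar> * log_weight R a)"
      using R1 by (intro sum_nonneg mult_nonneg_nonneg log_weight_nonneg) (auto simp: A_def)
    also have "\<dots> \<le> T" using L(3)[OF R1 generic] by (simp add: A_def T_def)
    finally have T0: "T \<ge> 0" .
    have M0: "M \<ge> 0"
    proof (cases "(\<lambda>\<theta>. \<bar>Re (g (rcis R \<theta>))\<bar>) integrable_on {0..2*pi}")
      case True
      thus ?thesis unfolding M_def by (rule integral_nonneg) auto
    qed (simp add: M_def not_integrable_integral)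
    have deriv_bound: "norm (deriv g z) \<le> B" if z: "z \<in> cball 0 (2 * r)" for z
    proof -
      have nz: "norm z \<le> R / 2" using z rR by simp
      have "norm (deriv g z) \<le> R / (pi * (R - norm z) ^ 2) * M"
        unfolding M_def by (rule norm_deriv_le_circle_integral_Re[OF g(1)]) (use nz R1 in auto)
      also have "\<dots> \<le> R / (pi * (R / 2) ^ 2) * M"
        using nz R1 M0 by (intro mult_right_mono divide_left_mono mult_left_mono power_mono mult_pos_pos zero_less_power) auto
      also have "R / (pi * (R / 2) ^ 2) = 4 / (pi * R)" using R1 by (simp add: power2_eq_square)
      finally show ?thesis by (simp add: B_def)
    qed
    have gdiff: "norm (g x - g y) \<le> B * norm (x - y)" if "x \<in> cball 0 (2 * r)" "y \<in> cball 0 (2 * r)" for x y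
    proof (rule field_differentiable_bound[OF convex_cball _ deriv_bound that])
      fix z :: complex assume z: "z \<in> cball 0 (2 * r)"
      have "g holomorphic_on ball 0 R" using g(1) by (rule holomorphic_on_subset) auto
      moreover have "z \<in> ball 0 R" using z rR r by auto
      ultimately have "(g has_field_derivative deriv g z) (at z)" by (intro holomorphic_derivI) auto
      thus "(g has_field_derivative deriv g z) (at z within cball 0 (2 * r))"
        by (rule has_field_derivative_at_within)
    qed
    \<comment> \<open>The translate of \<open>E\<close> excludes the angles at which
      \<open>z + w\<close> meets \<open>E\<close>.\<close>
    define X where "X = {\<theta> \<in> {0..2*pi}. rcis r \<theta> \<in> E \<union> (\<lambda>z. z - w) ` E}"
    have finX: "finite X" unfolding X_def by (rule finite_rcis_vimage[OF r]) (use g(2) in auto)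
    \<comment> \<open>Writing \<open>|z + w - a|\<close> as the distance from \<open>z\<close> to
      \<open>a - w\<close> makes the circle integral bound, uniform in the point, applicable to both
      powers.\<close>
    define D where "D = (\<lambda>\<theta>. (\<Sum>a\<in>A. \<bar>zorder f a\<bar> * (norm w powr d / d *
       (norm (rcis r \<theta> - (a - w)) powr -d + norm (rcis r \<theta> - a) powr -d))) + B * norm w)"
    have key: "f (rcis r \<theta>) \<noteq> 0" "f (rcis r \<theta> + w) \<noteq> 0"
      "\<bar>ln (norm (f (rcis r \<theta> + w))) - ln (norm (f (rcis r \<theta>)))\<bar> \<le> D \<theta>" if \<theta>: "\<theta> \<in> {0..2*pi} - X" for \<theta>
    proof -
      define z where "z = rcis r \<theta>"
      have zE: "z \<notin> E" "z + w \<notin> E"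
        using \<theta> unfolding X_def z_def by (auto simp: image_iff algebra_simps)
      have zr: "norm z \<le> r" "norm (z + w) \<le> 2 * r"
        using norm_triangle_ineq[of z w] w r by (auto simp: z_def)
      have z1: "z \<in> cball 0 R - E" "z + w \<in> cball 0 R - E" using zE zr rR r by auto
      show "f (rcis r \<theta>) \<noteq> 0" "f (rcis r \<theta> + w) \<noteq> 0" using g(4)[OF z1(1)] g(4)[OF z1(2)] by (auto simp: z_def)
      have "ln (norm (f (z + w))) - ln (norm (f z)) =
        (\<Sum>a\<in>A. zorder f a * (ln (norm (z + w - a) / R) - ln (norm (z - a) / R))) + Re (g (z + w) - g z)"
        unfolding g(5)[OF z1(1)] g(5)[OF z1(2)] by (simp add: sum_subtractf right_diff_distrib)
      also have "\<bar>\<dots>\<bar> \<le> (\<Sum>a\<in>A. \<bar>zorder f a * (ln (norm (z + w - a) / R) - ln (norm (z - a) / R))\<bar>) + \<bar>Re (g (z + w) - g z)\<bar>"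
        by (rule order.trans[OF abs_triangle_ineq add_right_mono[OF sum_abs]])
      also have "\<dots> \<le> D \<theta>" unfolding D_def
      proof (intro add_mono sum_mono)
        fix a assume a: "a \<in> A"
        have nz: "z + w - a \<noteq> 0" "z - a \<noteq> 0" using a g(3) zE by auto
        have "ln (norm (z + w - a) / R) - ln (norm (z - a) / R) = ln (norm ((z + w - a) / (z - a)))"
          using nz R1 by (simp add: norm_divide ln_div)
        also have "\<bar>\<dots>\<bar> \<le> norm ((z + w - a) - (z - a)) powr d / d * (norm (z + w - a) powr -d + norm (z - a) powr -d)"
          by (rule abs_ln_norm_divide_le) (use d nz in auto)
        also have "(z + w - a) - (z - a) = w" by simp
        finally have le: "\<bar>ln (norm (z + w - a) / R) - ln (norm (z - a) / R)\<bar> \<le>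
          norm w powr d / d * (norm (z + w - a) powr -d + norm (z - a) powr -d)" .
        have eq: "z - (a - w) = z + w - a" by simp
        show "\<bar>zorder f a * (ln (norm (z + w - a) / R) - ln (norm (z - a) / R))\<bar>
           \<le> \<bar>zorder f a\<bar> * (norm w powr d / d * (norm (rcis r \<theta> - (a - w)) powr -d + norm (rcis r \<theta> - a) powr -d))"
          unfolding abs_mult z_def[symmetric] eq of_int_abs by (rule mult_left_mono[OF le abs_ge_zero])
      next
        have "\<bar>Re (g (z + w) - g z)\<bar> \<le> norm (g (z + w) - g z)" by (rule abs_Re_le_cmod)
        also have "\<dots> \<le> B * norm (z + w - z)" by (rule gdiff) (use zr r in auto)
        finally show "\<bar>Re (g (z + w) - g z)\<bar> \<le> B * norm w" by simp
      qed
      finally show "\<bar>ln (norm (f (rcis r \<theta> + w))) - ln (norm (f (rcis r \<theta>)))\<bar> \<le> D \<theta>" by (simp add: z_def)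
    qed
    have B0: "B \<ge> 0" using M0 R1 by (simp add: B_def)
    have D0: "D \<theta> \<ge> 0" for \<theta>
      unfolding D_def using B0 d by (intro add_nonneg_nonneg sum_nonneg mult_nonneg_nonneg) auto
    let ?I = "\<lambda>b. integral {0..2*pi} (\<lambda>\<theta>. norm (rcis r \<theta> - b) powr -d)"
    have I: "((\<lambda>\<theta>. norm (rcis r \<theta> - b) powr -d) has_integral ?I b) {0..2*pi}" for b
      using K(2)[OF r] by (rule integrable_integral)
    have "((\<lambda>\<theta>. B * norm w) has_integral 2 * pi * (B * norm w)) {0..2*pi}"
      using has_integral_const_real[of "B * norm w" 0 "2 * pi"] by simp
    hence D: "(D has_integral (\<Sum>a\<in>A. \<bar>zorder f a\<bar> * (norm w powr d / d * (?I (a - w) + ?I a))) + 2 * pi * (B * norm w)) {0..2*pi}"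
      unfolding D_def by (intro has_integral_add has_integral_sum finA has_integral_mult_right I)
    hence Dint: "D integrable_on {0..2*pi}" by blast
    have "integral {0..2*pi} D = (\<Sum>a\<in>A. \<bar>zorder f a\<bar> * (norm w powr d / d * (?I (a - w) + ?I a))) + 2 * pi * (B * norm w)"
      using D by (rule integral_unique)
    also have "\<dots> \<le> (\<Sum>a\<in>A. \<bar>zorder f a\<bar> * (norm w powr d / d * (K * r powr -d + K * r powr -d))) + 2 * pi * (B * norm w)"
      using d by (intro add_right_mono sum_mono mult_left_mono add_mono K(3)[OF r]) auto
    also have "(\<Sum>a\<in>A. \<bar>zorder f a\<bar> * (norm w powr d / d * (K * r powr -d + K * r powr -d)))
        = n * (norm w powr d / d * (K * r powr -d + K * r powr -d))"
      by (simp add: n_def zero_pole_count_def A_def sum_distrib_right sum_divide_distrib)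
    also have "\<dots> = pi * (C1 * (n * (norm w / r) powr d))"
      using d r by (simp add: C1_def powr_divide powr_minus field_simps)
    also have "2 * pi * (B * norm w) \<le> pi * (C2 * (norm w / R * (T + n)))"
    proof -
      have "M \<le> 2 * pi * T + L * n" using g(6) by (simp add: M_def)
      also have "\<dots> \<le> (2 * pi + L) * T + (2 * pi + L) * n"
        using T0 n0 L(1) by (intro add_mono mult_right_mono) auto
      finally have "M \<le> (2 * pi + L) * (T + n)" by (simp add: distrib_left)
      hence "8 * (norm w / R) * M \<le> 8 * (norm w / R) * ((2 * pi + L) * (T + n))"
        using R1 by (intro mult_left_mono) auto
      moreover have e1: "2 * pi * (B * norm w) = 8 * (norm w / R) * M" by (simp add: B_def)
      moreover have e2: "pi * (C2 * (norm w / R * (T + n))) = 8 * (norm w / R) * ((2 * pi + L) * (T + n))"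
        by (simp add: C2_def mult_ac)
      ultimately show ?thesis unfolding e1 e2 by blast
    qed
    finally have Dle: "integral {0..2*pi} D \<le> pi * (C1 * (n * (norm w / r) powr d) + C2 * (norm w / R * (T + n)))"
      by (simp add: distrib_left)
    \<comment> \<open>Off \<open>X\<close>, each \<open>log_plus\<close> is the maximum of 0 and a
      signed difference of logarithms, and \<open>D\<close> dominates both.\<close>
    have le: "proximity r (\<lambda>z. f (z + w) / f z) \<le> 1 / (2 * pi) * integral {0..2*pi} D"
      "proximity r (\<lambda>z. f z / f (z + w)) \<le> 1 / (2 * pi) * integral {0..2*pi} D"
      unfolding proximity_def
      by (intro mult_left_mono integral_le_nonneg_majorant[OF Dint finX] D0;
          use key D0 in \<open>force simp: log_plus_def norm_divide ln_div abs_le_iff\<close>)+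
    define U where "U = n * (norm w / r) powr d"
    define V where "V = norm w / R * (T + n)"
    have UV: "U \<ge> 0" "V \<ge> 0" using n0 T0 R1 by (auto simp: U_def V_def)
    have "proximity r (\<lambda>z. f (z + w) / f z) + proximity r (\<lambda>z. f z / f (z + w)) \<le> 1 / pi * integral {0..2*pi} D"
      using le by simp
    also have "\<dots> \<le> 1 / pi * (pi * (C1 * U + C2 * V))"
      using Dle unfolding U_def V_def by (intro mult_left_mono) auto
    also have "\<dots> = C1 * U + C2 * V" by simp
    also have "\<dots> \<le> (C1 + C2) * U + (C1 + C2) * V"
      using C UV by (intro add_mono mult_right_mono) auto
    finally show "proximity r (\<lambda>z. f (z + w) / f z) + proximity r (\<lambda>z. f z / f (z + w))
        \<le> (C1 + C2) * (zero_pole_count R f * (norm w / r) powr d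
             + norm w / R * (2 * characteristic R f + \<bar>jensen_const f\<bar> + zero_pole_count R f))"
      by (simp add: U_def V_def T_def n_def distrib_left)
  qed (use C in auto)
qed

end

section \<open>From the growth order to the final estimate\<close>

lemma growth_order_nonneg: "0 \<le> growth_order f"
  unfolding growth_order_def
proof (rule le_Limsup)
  show "\<forall>\<^sub>F r in at_top. 0 \<le> ereal (log_plus (characteristic r f) / ln r)"
    using eventually_gt_at_top[of 1] by eventually_elim (simp add: log_plus_nonneg)
qed simp

lemma eventually_characteristic_le_powr:
  assumes "growth_order f < ereal p"
  shows "\<forall>\<^sub>F r in at_top. characteristic r f \<le> r powr p"
proof -
  have "\<forall>\<^sub>F r in at_top. ereal (log_plus (characteristic r f) / ln r) < ereal p"
    using assms unfolding growth_order_def by (rule Limsup_lessD)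
  thus ?thesis using eventually_gt_at_top[of 1]
  proof eventually_elim
    case (elim r)
    show ?case
    proof (cases "characteristic r f > 0")
      case True
      have "ln (characteristic r f) \<le> log_plus (characteristic r f)" by (simp add: log_plus_def)
      also have "\<dots> \<le> p * ln r" using elim by (simp add: field_simps)
      finally have "exp (ln (characteristic r f)) \<le> exp (p * ln r)" by simp
      thus ?thesis using True elim by (simp add: powr_def)
    next
      case False
      thus ?thesis using powr_ge_zero[of r p] by linarith
    qed
  qed
qed

theorem theorem3p1:
  fixes f :: "complex \<Rightarrow> complex" and \<omega> :: "real \<Rightarrow> complex" and \<sigma> \<beta> \<epsilon> :: real
  assumes "f meromorphic_on UNIV"
    and "\<not> (\<forall>\<^sub>F z in cosparse UNIV. f z = 0)"
    and "growth_order f = ereal \<sigma>"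
    and "0 < \<beta>" and "\<beta> < 1"
    and "\<And>r. r > 0 \<Longrightarrow> 0 < norm (\<omega> r) \<and> norm (\<omega> r) < r powr \<beta>"
    and "0 < \<epsilon>" and "\<epsilon> < (1 - \<beta>) / (2 - \<beta>)"
  shows "(\<lambda>r. proximity r (\<lambda>z. f (z + \<omega> r) / f z) + proximity r (\<lambda>z. f z / f (z + \<omega> r)))
           \<in> O(\<lambda>r. r powr (\<sigma> - (1 - \<beta>) * (1 - \<epsilon>) + \<epsilon>))"
proof -
  note f = assms(1,2)
  \<comment> \<open>This places \<open>1 - \<epsilon>\<close> strictly between 0 and 1, as the
    exponent \<open>d\<close> of the shift estimate requires.\<close>
  have "(1 - \<beta>) / (2 - \<beta>) < 1" using assms by (simp add: field_simps)
  hence d: "0 < 1 - \<epsilon>" "1 - \<epsilon> < 1" using assms by linarith+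
  have \<sigma>: "\<sigma> \<ge> 0" using growth_order_nonneg[of f] assms(3) by simp
  define p where "p = \<sigma> + \<epsilon>"
  have p: "p > 0" "growth_order f < ereal p" using \<sigma> assms by (auto simp: p_def)
  obtain r0 where r0: "\<And>r. r \<ge> r0 \<Longrightarrow> characteristic r f \<le> r powr p"
    using eventually_characteristic_le_powr[OF p(2)] unfolding eventually_at_top_linorder by blast
  obtain K where K: "K > 0"
    "\<And>r R w. 0 < r \<Longrightarrow> 1 \<le> R \<Longrightarrow> 4 * r \<le> R \<Longrightarrow> (\<And>z. z \<in> zeros_poles f \<Longrightarrow> norm z \<noteq> R) \<Longrightarrow> norm w \<le> r \<Longrightarrow>
      proximity r (\<lambda>z. f (z + w) / f z) + proximity r (\<lambda>z. f z / f (z + w))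
        \<le> K * (zero_pole_count R f * (norm w / r) powr (1 - \<epsilon>)
             + norm w / R * (2 * characteristic R f + \<bar>jensen_const f\<bar> + zero_pole_count R f))"
    by (rule proximity_shift_quotient_le[OF f d]) blast
  \<comment> \<open>All radii used lie below \<open>9 * r\<close>, whence \<open>9 powr p\<close>;
    the Jensen constant is absorbed using \<open>1 \<le> r powr p\<close>. The exponent
    \<open>b\<close> measures \<open>(norm w / r) powr (1 - \<epsilon>)\<close>.\<close>
  define Q where "Q = 2 * 9 powr p + \<bar>jensen_const f\<bar>"
  define b where "b = (\<beta> - 1) * (1 - \<epsilon>)"
  define C where "C = K * (Q / ln (3/2) + Q + Q / ln (3/2))"
  have Q: "Q \<ge> 0" by (simp add: Q_def)
  have lnc: "ln (3 / 2 :: real) > 0" by simp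
  have main: "proximity r (\<lambda>z. f (z + \<omega> r) / f z) + proximity r (\<lambda>z. f z / f (z + \<omega> r)) \<le> C * r powr (p + b)"
    if r: "r \<ge> r0" "r \<ge> 1" for r
  proof -
    define w where "w = \<omega> r"
    have wb: "norm w < r powr \<beta>" using assms(6)[of r] r by (auto simp: w_def)
    \<comment> \<open>The intervals keep \<open>3/2 * R < R'\<close>, so the count at
      \<open>R\<close> is controlled by the characteristic at \<open>R'\<close> with divisor
      \<open>ln (3/2)\<close>.\<close>
    obtain R where R: "4 * r < R" "R < 5 * r" "\<And>z. z \<in> zeros_poles f \<Longrightarrow> norm z \<noteq> R"
      using generic_radius[OF f, of "4 * r" "5 * r"] r by auto
    obtain R' where R': "8 * r < R'" "R' < 9 * r" "\<And>z. z \<in> zeros_poles f \<Longrightarrow> norm z \<noteq> R'"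
      using generic_radius[OF f, of "8 * r" "9 * r"] r by auto
    have rp: "1 \<le> r powr p" using r p by (intro ge_one_powr_ge_zero) auto
    have T: "2 * characteristic x f + \<bar>jensen_const f\<bar> \<le> Q * r powr p" if x: "r < x" "x < 9 * r" for x
    proof -
      have "characteristic x f \<le> x powr p" using x r by (intro r0) auto
      also have "\<dots> \<le> (9 * r) powr p" using x r p by (intro powr_mono2) auto
      also have "\<dots> = 9 powr p * r powr p" using r by (simp add: powr_mult)
      finally have "2 * characteristic x f \<le> 2 * 9 powr p * r powr p" by simp
      moreover have "\<bar>jensen_const f\<bar> * 1 \<le> \<bar>jensen_const f\<bar> * r powr p"
        using rp by (intro mult_left_mono) auto
      ultimately show ?thesis by (simp add: Q_def distrib_right)
    qed
    have "zero_pole_count R f * ln (3/2) \<le> 2 * characteristic R' f + \<bar>jensen_const f\<bar>"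
      by (rule zero_pole_count_le_characteristic[OF f]) (use R R' r in auto)
    also have "\<dots> \<le> Q * r powr p" using R' r by (intro T) auto
    finally have n: "zero_pole_count R f \<le> Q / ln (3/2) * r powr p"
      using lnc by (simp add: field_simps)
    have "norm w / r \<le> r powr \<beta> / r" using wb r by (intro divide_right_mono) auto
    also have "\<dots> = r powr (\<beta> - 1)" using r by (simp add: powr_diff)
    finally have wr: "norm w / r \<le> r powr (\<beta> - 1)" .
    have "(norm w / r) powr (1 - \<epsilon>) \<le> (r powr (\<beta> - 1)) powr (1 - \<epsilon>)"
      using wr d r by (intro powr_mono2) auto
    hence 1: "(norm w / r) powr (1 - \<epsilon>) \<le> r powr b" by (simp add: powr_powr b_def)
    have "norm w / R \<le> norm w / r" using R r by (intro divide_left_mono) auto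
    also note wr
    \<comment> \<open>As \<open>\<beta> - 1\<close> is negative, multiplying it by
      \<open>1 - \<epsilon> < 1\<close> increases it. The derivative term thus fits under the bound
      for the zeros and poles.\<close>
    also have "r powr (\<beta> - 1) \<le> r powr b"
      using mult_left_mono[of "1 - \<epsilon>" 1 "1 - \<beta>"] d assms r by (intro powr_mono) (auto simp: b_def algebra_simps)
    finally have 2: "norm w / R \<le> r powr b" .
    have "r powr \<beta> \<le> r powr 1" using r assms by (intro powr_mono) auto
    hence wr': "norm w \<le> r" using wb r by simp
    have n0: "zero_pole_count R f \<ge> 0" by (rule zero_pole_count_nonneg[OF f])
    have "proximity r (\<lambda>z. f (z + w) / f z) + proximity r (\<lambda>z. f z / f (z + w))
       \<le> K * (zero_pole_count R f * (norm w / r) powr (1 - \<epsilon>)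
             + norm w / R * (2 * characteristic R f + \<bar>jensen_const f\<bar> + zero_pole_count R f))"
      by (rule K(2)) (use R r wr' in auto)
    also have "\<dots> \<le> K * (Q / ln (3/2) * r powr p * r powr b + r powr b * (Q * r powr p + Q / ln (3/2) * r powr p))"
    proof (intro mult_left_mono add_mono)
      have Y0: "0 \<le> Q / ln (3/2)" by (rule divide_nonneg_pos[OF Q lnc])
      show "zero_pole_count R f * (norm w / r) powr (1 - \<epsilon>) \<le> Q / ln (3/2) * r powr p * r powr b"
        by (rule mult_mono[OF n 1]) (rule mult_nonneg_nonneg[OF Y0], rule powr_ge_zero, rule powr_ge_zero)
      have "norm w / R * (2 * characteristic R f + \<bar>jensen_const f\<bar> + zero_pole_count R f)
        \<le> norm w / R * (Q * r powr p + Q / ln (3/2) * r powr p)"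
        by (rule mult_left_mono[OF add_mono[OF T n]]) (use R r in auto)
      also have "\<dots> \<le> r powr b * (Q * r powr p + Q / ln (3/2) * r powr p)"
        by (rule mult_right_mono[OF 2], rule add_nonneg_nonneg; rule mult_nonneg_nonneg; fact Q Y0 powr_ge_zero)
      finally show "norm w / R * (2 * characteristic R f + \<bar>jensen_const f\<bar> + zero_pole_count R f)
        \<le> r powr b * (Q * r powr p + Q / ln (3/2) * r powr p)" .
    qed (use K(1) in simp)
    also have "\<dots> = C * r powr (p + b)" by (simp add: C_def powr_add algebra_simps)
    finally show ?thesis by (simp add: w_def)
  qed
  have e: "\<sigma> - (1 - \<beta>) * (1 - \<epsilon>) + \<epsilon> = p + b" by (simp add: p_def b_def algebra_simps)
  show ?thesis unfolding e
  proof (rule bigoI[of _ C])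
    show "\<forall>\<^sub>F r in at_top. norm (proximity r (\<lambda>z. f (z + \<omega> r) / f z) + proximity r (\<lambda>z. f z / f (z + \<omega> r))) \<le> C * norm (r powr (p + b))"
      using eventually_ge_at_top[of r0] eventually_ge_at_top[of 1]
    proof eventually_elim
      case (elim r)
      show ?case using main[OF elim] proximity_nonneg[of r "\<lambda>z. f (z + \<omega> r) / f z"] proximity_nonneg[of r "\<lambda>z. f z / f (z + \<omega> r)"] by simp
    qed
  qed
qed

end
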